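(* Let $\Delta\subset\mathbb{R}^n$ be a Delzant polytope, let $(X_\Delta,L_\Delta)$ be the associated polarized toric manifold, and let $p\in X_\Delta$ be a fixed point of the torus action. Then $$\phi_{L_\Delta,p}+O(1)=\phi_{\Delta,p}+O(1),$$ i.e. the plurisubharmonic functions $\phi_{L_\Delta,p}$ and $\phi_{\Delta,p}$ on $T_pX_\Delta$ differ by a bounded function.
   Context: Toric growth condition. A Delzant polytope $\Delta$ is the convex hull of finitely many points of $\mathbb{Z}^n$ such that each vertex has a neighbourhood in $\Delta$ isomorphic, via translations and the action of $GL(n,\mathbb{Z})$, to a neighbourhood of the origin in the positive orthant $\mathbb{R}^n_{\ge0}$. It determines a smooth projective toric manifold $X_\Delta$ with an ample toric line bundle $L_\Delta$. Torus-fixed points $p$ correspond to vertices of $\Delta$. Given $p$, move $\Delta$ (by translation and $GL(n,\mathbb{Z})$) so that it lies in the positive orthant and the vertex corresponding to $p$ is the origin. This gives an open embedding $\mathbb{C}^n\subseteq X_\Delta$ on which the torus action is standard, with $p$ equal to the origin, and a natural trivialization of $L_\Delta$ over $\mathbb{C}^n$ for which restriction to $\mathbb{C}^n$ gives $H^0(X_\Delta,kL_\Delta)\cong\bigoplus_{\alpha\in k\Delta\cap\mathbb{Z}^n}\langle z^\alpha\rangle$. Here $kL=L^{\otimes k}$. For $k$ with $kL_\Delta$ very ample put $$\phi_{\Delta,p}:=\frac1k\log\Big(\sum_{\alpha\in k\Delta\cap\mathbb{Z}^n}|z^\alpha|^2\Big)$$ on $\mathbb{C}^n$, regarded as a function on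 $T_pX_\Delta$ via the identification $\mathbb{C}^n\cong T_pX_\Delta$ given by these coordinates. Up to a bounded term it does not depend on the choice of $k$. Canonical growth condition. Let $L$ be a line bundle on a projective manifold $X$ of dimension $n$ and $p\in X$. A smooth metric $\phi$ on $L$ (not necessarily positive) is given additively by local smooth real functions $\phi_i$ with $\phi_i=\phi_j+\ln|g_{ij}|^2$, where $g_{ij}$ are the transition functions of $L$, and $|s|^2e^{-k\phi}$ is the pointwise squared norm of a section $s$ of $kL$. Fix local holomorphic coordinates $z_i$ centered at $p$ (identifying $T_pX$ with $\mathbb{C}^n$) and a local trivialization of $L$ near $p$. For $0\neq s\in H^0(X,kL)$, with local Taylor series $s=\sum a_\alpha z^\alpha$, let $ord_p(s)$ be the vanishing order at $p$ and $s_{hom}:=\sum_{|\alpha|=ord_p(s)}a_\alpha z^\alpha$, a homogeneous polynomial on $T_pX$. Let $B_1(kL,k\phi):=\{s\in H^0(X,kL):\sup_X|s|^2e^{-k\phi}\le1\}$ and $$\phi_{L,p}:=\sup{}^*\Big\{\tfrac1k\ln|s_{hom}|^2: s\in B_1(kL,k\phi)\setminus\{0\},\ k\ge1\Big\},$$ where $^*$ is upper semicontinuous regularization. Up to a bounded term $\phi_{L,p}$ does not depend on the choices of $\phi$ and of the trivialization. *)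

theory Defs
  imports "HOL-Analysis.Analysis"
begin

section \<open>Holomorphic and smooth functions on open subsets of complex n-space\<close>

definition holo_on :: "(complex^'n) set \<Rightarrow> (complex^'n \<Rightarrow> complex) \<Rightarrow> bool" where
  "holo_on S f \<longleftrightarrow>
     (\<forall>z\<in>S. \<exists>D. (f has_derivative D) (at z) \<and> (\<forall>c v. D (c *s v) = c * D v))"

definition holo_map_on :: "(complex^'n) set \<Rightarrow> (complex^'n \<Rightarrow> complex^'n) \<Rightarrow> bool" where
  "holo_map_on S F \<longleftrightarrow> (\<forall>l. holo_on S (\<lambda>z. F z $ l))"

text \<open>For open \<open>S\<close>: all iterated directional derivatives of order at most \<open>k\<close> exist in the
  Frechet sense and are continuous.\<close>
fun Ck_on :: "nat \<Rightarrow> ('v::real_normed_vector \<Rightarrow> real) \<Rightarrow> 'v set \<Rightarrow> bool" where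
  "Ck_on 0 f S \<longleftrightarrow> continuous_on S f"
| "Ck_on (Suc k) f S \<longleftrightarrow> (\<forall>x\<in>S. f differentiable (at x)) \<and>
     (\<forall>v. Ck_on k (\<lambda>x. frechet_derivative f (at x) v) S)"

definition smooth_on :: "'v::real_normed_vector set \<Rightarrow> ('v \<Rightarrow> real) \<Rightarrow> bool" where
  "smooth_on S f \<longleftrightarrow> (\<forall>k. Ck_on k f S)"

definition monomial :: "nat^'n \<Rightarrow> complex^'n \<Rightarrow> complex" where
  "monomial \<alpha> z = (\<Prod>l\<in>UNIV. z $ l ^ (\<alpha> $ l))"

definition total_deg :: "nat^'n \<Rightarrow> nat" where
  "total_deg \<alpha> = (\<Sum>l\<in>UNIV. \<alpha> $ l)"

definition taylor_coeffs :: "(complex^'n \<Rightarrow> complex) \<Rightarrow> nat^'n \<Rightarrow> complex" where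
  "taylor_coeffs f =
     (THE a. \<forall>\<^sub>F z in nhds 0. ((\<lambda>\<alpha>. a \<alpha> * monomial \<alpha> z) has_sum f z) UNIV)"

definition vanishing_order :: "(complex^'n \<Rightarrow> complex) \<Rightarrow> nat" where
  "vanishing_order f = (LEAST m. \<exists>\<alpha>. total_deg \<alpha> = m \<and> taylor_coeffs f \<alpha> \<noteq> 0)"

definition hom_part :: "(complex^'n \<Rightarrow> complex) \<Rightarrow> complex^'n \<Rightarrow> complex" where
  "hom_part f z =
     (\<Sum>\<alpha> | total_deg \<alpha> = vanishing_order f. taylor_coeffs f \<alpha> * monomial \<alpha> z)"

section \<open>Line bundles and the canonical growth condition\<close>

text \<open>A holomorphic line bundle, given by a trivializing atlas of its base manifold, whose points
  have type \<open>'a\<close>.  Charts go from coordinate space to the manifold: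
  \<open>par L i\<close> maps the open set \<open>cdom L i\<close> injectively onto the chart domain \<open>patch L i\<close>.
  A section of the bundle is a family \<open>s i\<close> of functions on the patches with
  \<open>s i x = trf L i j x * s j x\<close>; a section of its \<open>k\<close>-th power transforms with
  the \<open>k\<close>-th power of \<open>trf L i j\<close>.  The record is bare data: holomorphic compatibility of the
  charts and the cocycle condition are not imposed, and hold for \<open>toric_bundle\<close> below when
  \<open>\<Delta>\<close> is Delzant.\<close>
record ('i, 'a, 'n) line_bundle =
  idx :: "'i set"
  cdom :: "'i \<Rightarrow> (complex^'n) set"
  par :: "'i \<Rightarrow> complex^'n \<Rightarrow> 'a"
  trf :: "'i \<Rightarrow> 'i \<Rightarrow> 'a \<Rightarrow> complex"

definition patch :: "('i, 'a, 'n::finite) line_bundle \<Rightarrow> 'i \<Rightarrow> 'a set" where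
  "patch L i = par L i ` cdom L i"

definition base :: "('i, 'a, 'n::finite) line_bundle \<Rightarrow> 'a set" where
  "base L = (\<Union>i\<in>idx L. patch L i)"

definition hol_sections :: "('i, 'a, 'n::finite) line_bundle \<Rightarrow> nat \<Rightarrow> ('i \<Rightarrow> 'a \<Rightarrow> complex) set" where
  "hol_sections L k = {s.
     (\<forall>i\<in>idx L. holo_on (cdom L i) (s i \<circ> par L i)) \<and>
     (\<forall>i\<in>idx L. \<forall>j\<in>idx L. \<forall>x\<in>patch L i \<inter> patch L j. s i x = trf L i j x ^ k * s j x)}"

definition nonzero_section :: "('i, 'a, 'n::finite) line_bundle \<Rightarrow> ('i \<Rightarrow> 'a \<Rightarrow> complex) \<Rightarrow> bool" where
  "nonzero_section L s \<longleftrightarrow> (\<exists>i\<in>idx L. \<exists>x\<in>patch L i. s i x \<noteq> 0)"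

definition smooth_metric :: "('i, 'a, 'n::finite) line_bundle \<Rightarrow> ('i \<Rightarrow> 'a \<Rightarrow> real) \<Rightarrow> bool" where
  "smooth_metric L \<phi> \<longleftrightarrow>
     (\<forall>i\<in>idx L. smooth_on (cdom L i) (\<phi> i \<circ> par L i)) \<and>
     (\<forall>i\<in>idx L. \<forall>j\<in>idx L. \<forall>x\<in>patch L i \<inter> patch L j.
        \<phi> i x = \<phi> j x + ln ((cmod (trf L i j x))\<^sup>2))"

definition unit_ball_sections ::
    "('i, 'a, 'n::finite) line_bundle \<Rightarrow> ('i \<Rightarrow> 'a \<Rightarrow> real) \<Rightarrow> nat \<Rightarrow> ('i \<Rightarrow> 'a \<Rightarrow> complex) set" where
  "unit_ball_sections L \<phi> k = {s \<in> hol_sections L k.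
     \<forall>i\<in>idx L. \<forall>x\<in>patch L i. (cmod (s i x))\<^sup>2 * exp (- real k * \<phi> i x) \<le> 1}"

text \<open>Holomorphic compatibility of two parametrized charts.\<close>
definition hol_compatible ::
    "(complex^'n) set \<Rightarrow> (complex^'n \<Rightarrow> 'a) \<Rightarrow> (complex^'n) set \<Rightarrow> (complex^'n \<Rightarrow> 'a) \<Rightarrow> bool" where
  "hol_compatible V f W h \<longleftrightarrow>
     open (V \<inter> f -` (h ` W)) \<and> holo_map_on (V \<inter> f -` (h ` W)) (inv_into W h \<circ> f) \<and>
     open (W \<inter> h -` (f ` V)) \<and> holo_map_on (W \<inter> h -` (f ` V)) (inv_into V f \<circ> h)"

text \<open>Local holomorphic coordinates centered at \<open>p\<close>, given by their inverse \<open>\<theta> : W \<rightarrow> X\<close>,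
  together with a trivialization of the bundle over \<open>\<theta> ` W\<close>: in it, a section of the \<open>k\<close>-th
  power is represented by the function \<open>\<tau> i x ^ k * s i x\<close>, for any \<open>i\<close> with \<open>x\<close> in the
  \<open>i\<close>-th patch.\<close>
definition local_frame :: "('i, 'a, 'n::finite) line_bundle \<Rightarrow> 'a \<Rightarrow>
    (complex^'n) set \<Rightarrow> (complex^'n \<Rightarrow> 'a) \<Rightarrow> ('i \<Rightarrow> 'a \<Rightarrow> complex) \<Rightarrow> bool" where
  "local_frame L p W \<theta> \<tau> \<longleftrightarrow>
     open W \<and> 0 \<in> W \<and> \<theta> 0 = p \<and> inj_on \<theta> W \<and> \<theta> ` W \<subseteq> base L \<and>
     (\<forall>i\<in>idx L. hol_compatible (cdom L i) (par L i) W \<theta>) \<and>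
     (\<forall>i\<in>idx L. holo_on (cdom L i \<inter> par L i -` (\<theta> ` W)) (\<tau> i \<circ> par L i)) \<and>
     (\<forall>i\<in>idx L. \<forall>x\<in>patch L i \<inter> \<theta> ` W. \<tau> i x \<noteq> 0) \<and>
     (\<forall>i\<in>idx L. \<forall>j\<in>idx L. \<forall>x\<in>patch L i \<inter> patch L j \<inter> \<theta> ` W. \<tau> j x = \<tau> i x * trf L i j x)"

definition local_expr :: "('i, 'a, 'n::finite) line_bundle \<Rightarrow> (complex^'n \<Rightarrow> 'a) \<Rightarrow>
    ('i \<Rightarrow> 'a \<Rightarrow> complex) \<Rightarrow> nat \<Rightarrow> ('i \<Rightarrow> 'a \<Rightarrow> complex) \<Rightarrow> complex^'n \<Rightarrow> complex" where
  "local_expr L \<theta> \<tau> k s w =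
     (let i = (SOME i. i \<in> idx L \<and> \<theta> w \<in> patch L i) in \<tau> i (\<theta> w) ^ k * s i (\<theta> w))"

definition ln_abs_sq :: "complex \<Rightarrow> ereal" where
  "ln_abs_sq c = (if c = 0 then -\<infinity> else ereal (ln ((cmod c)\<^sup>2)))"

text \<open>The filter \<open>nhds z\<close> does not exclude \<open>z\<close>, so this is the upper semicontinuous
  regularization in the sense of the smallest upper semicontinuous majorant.\<close>
definition usc_reg :: "('b::topological_space \<Rightarrow> ereal) \<Rightarrow> 'b \<Rightarrow> ereal" where
  "usc_reg u z = Limsup (nhds z) u"

text \<open>The function \<open>\<phi>\<^bsub>L,p\<^esub>\<close>, on the tangent space at \<open>p = \<theta> 0\<close> identified with coordinate
  space by the coordinates inverse to \<open>\<theta>\<close>.\<close>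
definition canonical_growth :: "('i, 'a, 'n::finite) line_bundle \<Rightarrow> ('i \<Rightarrow> 'a \<Rightarrow> real) \<Rightarrow>
    (complex^'n \<Rightarrow> 'a) \<Rightarrow> ('i \<Rightarrow> 'a \<Rightarrow> complex) \<Rightarrow> complex^'n \<Rightarrow> ereal" where
  "canonical_growth L \<phi> \<theta> \<tau> =
     usc_reg (\<lambda>z. SUP (k, s) \<in> {(k, s). 1 \<le> k \<and> s \<in> unit_ball_sections L \<phi> k \<and> nonzero_section L s}.
       ereal (1 / real k) * ln_abs_sq (hom_part (local_expr L \<theta> \<tau> k s) z))"

section \<open>Delzant polytopes\<close>

definition rvec :: "int^'n \<Rightarrow> real^'n" where
  "rvec m = (\<chi> l. real_of_int (m $ l))"

definition orthant :: "(real^'n) set" where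
  "orthant = {x. \<forall>l. 0 \<le> x $ l}"

definition moved :: "real^'n \<Rightarrow> int^'n^'n \<Rightarrow> (real^'n) set \<Rightarrow> (real^'n) set" where
  "moved v A \<Delta> = (\<lambda>x. map_matrix real_of_int A *v (x - v)) ` \<Delta>"

text \<open>Invertibility of the integer matrix \<open>A\<close> means that it lies in \<open>GL(n,\<int>)\<close>.\<close>
definition straightens :: "(real^'n) set \<Rightarrow> real^'n \<Rightarrow> int^'n^'n \<Rightarrow> bool" where
  "straightens \<Delta> v A \<longleftrightarrow> invertible A \<and>
     (\<exists>\<epsilon>>0. moved v A \<Delta> \<inter> ball 0 \<epsilon> = orthant \<inter> ball 0 \<epsilon>)"

definition delzant :: "(real^'n) set \<Rightarrow> bool" where
  "delzant \<Delta> \<longleftrightarrow> (\<exists>S. finite S \<and> \<Delta> = convex hull (rvec ` S)) \<and>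
     (\<forall>v. v extreme_point_of \<Delta> \<longrightarrow> (\<exists>A. straightens \<Delta> v A))"

text \<open>Pairs of a vertex (which is a lattice point) and a linear part of an affine
  transformation moving the vertex to the origin and \<open>\<Delta>\<close> into the positive orthant.  That
  \<open>moved (rvec v) A \<Delta> \<subseteq> orthant\<close> follows from convexity.\<close>
definition vertex_frames :: "(real^'n) set \<Rightarrow> ((int^'n) \<times> (int^'n^'n)) set" where
  "vertex_frames \<Delta> =
     {(v, A). rvec v extreme_point_of \<Delta> \<and> straightens \<Delta> (rvec v) A}"

section \<open>The polarized toric manifold of a Delzant polytope\<close>

definition lmonomial :: "int^'n \<Rightarrow> complex^'n \<Rightarrow> complex" where
  "lmonomial m z = (\<Prod>l\<in>UNIV. z $ l powi (m $ l))"

text \<open>The toric manifold is glued from one copy of complex n-space for each vertex frame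
  \<open>(v, A)\<close>, in whose coordinates \<open>z\<close> the character \<open>\<chi>\<^sup>m\<close> of the torus is the Laurent monomial with
  exponent \<open>A m\<close>.  A point of it is determined by the values at it of those characters that are
  regular there (as rational functions), and is encoded as this partial function on the character
  lattice.  So two points of different charts are identified iff the same characters are regular
  at them and take the same values, which is the gluing of the affine toric varieties of the cones
  of the normal fan along those of their common faces.\<close>
type_synonym 'n toric_point = "int^'n \<Rightarrow> complex option"

definition toric_param :: "int^'n^'n \<Rightarrow> complex^'n \<Rightarrow> 'n toric_point" where
  "toric_param A z m =
     (if \<forall>l. z $ l = 0 \<longrightarrow> 0 \<le> (A *v m) $ l then Some (lmonomial (A *v m) z) else None)"

text \<open>In the chart of \<open>(v, A)\<close>, the generator of the bundle is the section \<open>\<chi>\<^sup>v\<close>, so the section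
  \<open>\<chi>\<^sup>m\<close>, for a lattice point \<open>m\<close> of \<open>\<Delta>\<close>, is represented by \<open>\<chi>\<^bsup>m-v\<^esup>\<close>, the monomial
  with exponent \<open>A (m - v)\<close>.\<close>
definition toric_bundle :: "(real^'n) set \<Rightarrow> ((int^'n) \<times> (int^'n^'n), 'n toric_point, 'n) line_bundle" where
  "toric_bundle \<Delta> =
     \<lparr> idx = vertex_frames \<Delta>,
       cdom = (\<lambda>_. UNIV),
       par = (\<lambda>(v, A). toric_param A),
       trf = (\<lambda>(v, A) (w, B) x. the (x (w - v))) \<rparr>"

definition toric_manifold :: "(real^'n) set \<Rightarrow> 'n toric_point set" where
  "toric_manifold \<Delta> = base (toric_bundle \<Delta>)"

definition torus :: "(complex^'n) set" where
  "torus = {t. \<forall>l. t $ l \<noteq> 0}"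

definition torus_act :: "complex^'n \<Rightarrow> 'n::finite toric_point \<Rightarrow> 'n toric_point" where
  "torus_act t x m = map_option (\<lambda>c. lmonomial m t * c) (x m)"

definition torus_fixed :: "'n::finite toric_point \<Rightarrow> bool" where
  "torus_fixed x \<longleftrightarrow> (\<forall>t\<in>torus. torus_act t x = x)"

definition toric_growth :: "(real^'n) set \<Rightarrow> int^'n \<Rightarrow> int^'n^'n \<Rightarrow> nat \<Rightarrow> complex^'n \<Rightarrow> real" where
  "toric_growth \<Delta> v A k z =
     1 / real k * ln (\<Sum>\<alpha> | rvec \<alpha> \<in> (\<lambda>x. real k *\<^sub>R x) ` moved (rvec v) A \<Delta>. (cmod (lmonomial \<alpha> z))\<^sup>2)"

text \<open>Torus-fixed points are the origins of the vertex charts.\<close>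
lemma toric_fixed_point_is_vertex:
  fixes \<Delta> :: "(real^'n) set"
  assumes "p \<in> toric_manifold \<Delta>" and "torus_fixed p"
  shows "\<exists>(v, A) \<in> vertex_frames \<Delta>. toric_param A 0 = p"
proof -
  from assms(1) obtain v A z where vA: "(v, A) \<in> vertex_frames \<Delta>" and p: "p = toric_param A z"
    by (auto simp: toric_manifold_def base_def patch_def toric_bundle_def)
  have "invertible A" using vA by (auto simp: vertex_frames_def straightens_def)
  then obtain B where B: "A ** B = mat 1" "B ** A = mat 1" unfolding invertible_def by blast
  have "z $ l = 0" for l
  proof (rule ccontr)
    assume nz: "z $ l \<noteq> 0"
    define m where "m = B *v axis l 1"
    have Am: "A *v m = axis l 1"
      unfolding m_def matrix_vector_mul_assoc B(1) by simp
    have "m \<noteq> 0" using Am by (metis axis_eq_0_iff matrix_vector_mult_0_right zero_neq_one)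
    then obtain j where j: "m $ j \<noteq> 0" by (metis vec_eq_iff zero_index)
    define t :: "complex^'n" where "t = (\<chi> i. if i = j then 2 else 1)"
    have "t \<in> torus" by (simp add: torus_def t_def)
    have "lmonomial m t = (\<Prod>i\<in>UNIV. if i = j then 2 powi (m $ j) else 1)"
      unfolding lmonomial_def t_def by (rule prod.cong) auto
    then have tm: "lmonomial m t = 2 powi (m $ j)" by simp
    have pow2: "(2::complex) ^ N \<noteq> 1" if "0 < N" for N
    proof
      assume "(2::complex) ^ N = 1"
      then have "of_nat (2 ^ N) = (of_nat 1 :: complex)" by simp
      then have "2 ^ N = (1::nat)" by (simp only: of_nat_eq_iff)
      then show False using that by simp
    qed
    have ne1: "(2::complex) powi (m $ j) \<noteq> 1"
    proof (cases "0 \<le> m $ j")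
      case True
      then show ?thesis using pow2[of "nat (m $ j)"] j by (simp add: power_int_def)
    next
      case False
      then have "(2::complex) powi (m $ j) = inverse (2 ^ nat (- (m $ j)))"
        by (simp add: power_int_def power_one_over inverse_eq_divide)
      moreover have "(2::complex) ^ nat (- (m $ j)) \<noteq> 1" using False by (intro pow2) simp
      ultimately show ?thesis by (simp only: inverse_eq_1_iff not_False_eq_True)
    qed
    have "p m = Some (lmonomial (A *v m) z)"
      by (auto simp: p toric_param_def Am axis_def)
    moreover have "lmonomial (A *v m) z = z $ l"
    proof -
      have "lmonomial (A *v m) z = (\<Prod>i\<in>UNIV. if i = l then z $ l else 1)"
        unfolding lmonomial_def Am axis_def by (rule prod.cong) auto
      then show ?thesis by simp
    qed
    ultimately have pm: "p m = Some (z $ l)" by simp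
    have "torus_act t p m = p m" using assms(2) \<open>t \<in> torus\<close> by (simp add: torus_fixed_def)
    then show False using pm nz ne1 tm by (simp add: torus_act_def)
  qed
  then have "z = 0" by (simp add: vec_eq_iff)
  then show ?thesis using vA p by auto
qed

end

theory Submission
  imports Defs "HOL-Complex_Analysis.Complex_Analysis"
begin

text \<open>By compactness of the toric manifold, the metric \<open>\<phi>\<close> differs from the toric growth
  function by a bounded amount on the chart of \<open>p\<close>.  For the upper bound, a section in the unit
  ball is represented by an entire function \<open>f\<close>; its leading part at \<open>\<xi>\<close> is the value at \<open>0\<close> of
  the entire function \<open>f (c \<xi>) / c ^ m\<close> of \<open>c\<close>, so the maximum principle bounds it by \<open>f\<close> on the
  torus orbit of \<open>\<xi>\<close>.  For the lower bound, suitably rescaled characters of the vertices of \<open>\<Delta>\<close> are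
  sections in the unit ball.  Multivariate Taylor expansions are only needed to see that
  \<open>hom_part\<close> is such a limit; they are obtained one variable at a time from difference
  quotients.\<close>

text \<open>Three points decide the form of the estimates. (1) The supremum runs over all powers of
  the bundle, so bounds must be uniform in the power j: a unit-ball section is at most exp(j * (C +
  T) / 2) in modulus on the chart, T being the toric growth, and taking the logarithm of the square
  and dividing by j removes j. The vanishing order m drops out because |c^m| = 1 on the unit circle.
  (2) The frame is arbitrary. Its leading part at \<open>D \<xi>\<close> is t^j times the one in the
  toric chart at \<xi>, so the frame costs only the constant ln |t|^2. (3) Metric and polytope meet
  in the maximum over the vertices w of ln |chi^w|^2. On the torus the logarithm of the modulus of a
  character is linear in its exponent, so this maximum agrees with the toric growth up to the
  logarithm of the number of exponents. Hence power 1 and vertices are enough for the lower bound,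
  and comparisons are made on the torus and extended by density. The upper bound is continuous, so
  it survives the regularization; the lower bound already holds before it.\<close>

no_notation fps_nth (infixl "$" 75)

section \<open>Difference quotients of separately holomorphic functions\<close>

definition upd :: "'a^'n \<Rightarrow> 'n \<Rightarrow> 'a \<Rightarrow> 'a^'n" where
  "upd z i c = (\<chi> l. if l = i then c else z $ l)"

lemma upd_nth [simp]: "upd z i c $ l = (if l = i then c else z $ l)"
  by (simp add: upd_def)

lemma upd_idem [simp]: "upd (upd z i c) i d = upd z i d"
  by (simp add: vec_eq_iff)

lemma upd_triv [simp]: "upd z i (z $ i) = z"
  by (simp add: vec_eq_iff)

lemma upd_commute: "i \<noteq> j \<Longrightarrow> upd (upd z i c) j d = upd (upd z j d) i c"
  by (auto simp: vec_eq_iff)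

definition polydisc :: "real \<Rightarrow> (complex^'n) set" where
  "polydisc R = {z. \<forall>l. cmod (z $ l) < R}"

text \<open>The class is chosen to be stable under difference quotients on a fixed polydisc; the
  uniform bound stands in for joint continuity.\<close>

definition bounded_sep_holo :: "real \<Rightarrow> real \<Rightarrow> (complex^'n \<Rightarrow> complex) \<Rightarrow> bool" where
  "bounded_sep_holo R M g \<longleftrightarrow>
     (\<forall>z\<in>polydisc R. cmod (g z) \<le> M \<and> (\<forall>i. (\<lambda>c. g (upd z i c)) holomorphic_on ball 0 R))"

text \<open>Drops the constant term in the \<open>i\<close>-th variable and divides by that
  variable. The \<open>k\<close>-th iterate at \<open>z $ i = 0\<close> is therefore the
  \<open>k\<close>-th Taylor coefficient in this variable, still a function of the others.\<close>

definition diff_quot :: "'n \<Rightarrow> (complex^'n \<Rightarrow> complex) \<Rightarrow> complex^'n \<Rightarrow> complex" where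
  "diff_quot i g z =
     (if z $ i = 0 then deriv (\<lambda>c. g (upd z i c)) 0 else (g z - g (upd z i 0)) / z $ i)"

lemma upd_polydisc: "z \<in> polydisc R \<Longrightarrow> cmod c < R \<Longrightarrow> upd z i c \<in> polydisc R"
  by (auto simp: polydisc_def)

text \<open>The singularity at 0 is removable, and on the circle of radius \<open>r\<close> the
  quotient is at most \<open>2 * M / r\<close>. The maximum principle carries this inside, and
  \<open>r\<close> may approach \<open>R\<close>; so the disc does not shrink and the step can be
  iterated.\<close>

lemma diff_quot_one_var:
  assumes h: "h holomorphic_on ball 0 R" and R: "0 < R"
    and M: "\<And>z. z \<in> ball 0 R \<Longrightarrow> cmod (h z) \<le> M"
  defines "q \<equiv> \<lambda>z. if z = 0 then deriv h 0 else (h z - h 0) / z"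
  shows "q holomorphic_on ball 0 R" and "\<And>z. z \<in> ball 0 R \<Longrightarrow> cmod (q z) \<le> 2 * M / R"
proof -
  show q: "q holomorphic_on ball 0 R"
    using pole_lemma_open[OF h open_ball, of 0] by (simp add: q_def cong: if_cong)
  fix z :: complex assume z: "z \<in> ball 0 R"
  have *: "cmod (q z) * r \<le> 2 * M" if r: "cmod z < r" "r < R" for r
  proof -
    have r0: "0 < r" using r(1) norm_ge_zero[of z] by linarith
    have "cmod (q z) \<le> 2 * M / r"
    proof (rule maximum_modulus_frontier[of q "ball 0 r"])
      show "q holomorphic_on interior (ball 0 r)"
        using q by (rule holomorphic_on_subset) (use r in auto)
      have "continuous_on (ball 0 R) q" using q by (rule holomorphic_on_imp_continuous_on)
      then show "continuous_on (closure (ball 0 r)) q"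
        by (rule continuous_on_subset) (use r r0 in auto)
      show "bounded (ball 0 r)" "z \<in> ball 0 r" using r by auto
      fix w assume "w \<in> frontier (ball (0::complex) r)"
      then have w: "cmod w = r" using r0 by (simp add: frontier_ball)
      then have "cmod (h w - h 0) \<le> 2 * M"
        using norm_triangle_ineq4[of "h w" "h 0"] M[of w] M[of 0] r R by auto
      then show "cmod (q w) \<le> 2 * M / r"
        using w r0 by (auto simp: q_def norm_divide divide_simps)
    qed
    then show ?thesis using r0 by (simp add: field_simps)
  qed
  show "cmod (q z) \<le> 2 * M / R"
  proof (rule ccontr)
    assume "\<not> ?thesis"
    then have lt: "2 * M < cmod (q z) * R" using R by (simp add: field_simps)
    have M0: "0 \<le> M" using order_trans[OF norm_ge_zero M[of 0]] R by simp
    have qz: "0 < cmod (q z)" using lt M0 R by (auto simp: q_def zero_less_mult_iff split: if_splits)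
    then have "2 * M / cmod (q z) < R" using lt by (simp add: field_simps)
    then have "max (cmod z) (2 * M / cmod (q z)) < R" using z by simp
    then obtain r where r: "max (cmod z) (2 * M / cmod (q z)) < r" "r < R" using dense by blast
    then have "2 * M < cmod (q z) * r" using qz by (simp add: field_simps)
    with *[of r] r show False by simp
  qed
qed

lemma diff_quot_upd:
  "diff_quot i g (upd z i c) =
     (if c = 0 then deriv (\<lambda>c. g (upd z i c)) 0 else (g (upd z i c) - g (upd z i 0)) / c)"
  by (simp add: diff_quot_def)

text \<open>The delicate case is holomorphy in a variable \<open>j\<close> other than
  \<open>i\<close> at points with \<open>z $ i = 0\<close>, where the quotient is a partial
  derivative. There it is a uniform limit of genuine quotients with \<open>z $ i\<close>
  nonzero.\<close>

lemma bounded_sep_holo_diff_quot: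
  assumes g: "bounded_sep_holo R M g" and R: "0 < R"
  shows "bounded_sep_holo R (2 / R * M) (diff_quot i g)"
proof -
  have h: "(\<lambda>c. g (upd z j c)) holomorphic_on ball 0 R" if "z \<in> polydisc R" for z j
    using g that by (auto simp: bounded_sep_holo_def)
  have b: "cmod (g (upd z j c)) \<le> M" if "z \<in> polydisc R" "c \<in> ball 0 R" for z j c
    using g upd_polydisc[OF that(1)] that(2) by (auto simp: bounded_sep_holo_def)
  have qh: "(\<lambda>c. diff_quot i g (upd z i c)) holomorphic_on ball 0 R" if "z \<in> polydisc R" for z
    using diff_quot_one_var(1)[OF h[OF that] R b[OF that]] by (simp add: diff_quot_upd)
  have qb: "cmod (diff_quot i g (upd z i c)) \<le> 2 * M / R" if "z \<in> polydisc R" "c \<in> ball 0 R" for z c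
    using diff_quot_one_var(2)[OF h[OF that(1)] R b[OF that(1)] that(2)] by (simp add: diff_quot_upd)
  \<comment> \<open>The one-variable bound, applied to the quotient itself, gives a Lipschitz
    estimate at 0 in the \<open>i\<close>-th variable that is uniform in the other
    variables.\<close>
  have lip: "cmod (diff_quot i g (upd z i c) - diff_quot i g (upd z i 0)) \<le> 2 * (2 * M / R) / R * cmod c"
    if z: "z \<in> polydisc R" and c: "c \<in> ball 0 R" for z c
  proof (cases "c = 0")
    case False
    then show ?thesis using diff_quot_one_var(2)[OF qh[OF z] R qb[OF z] c]
      by (simp add: norm_divide field_simps)
  qed simp
  show ?thesis unfolding bounded_sep_holo_def
  proof (intro ballI conjI allI)
    fix z :: "complex^'a" and j assume z: "z \<in> polydisc R"
    show "cmod (diff_quot i g z) \<le> 2 / R * M"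
      using qb[OF z, of "z $ i"] z by (simp add: polydisc_def)
    show "(\<lambda>c. diff_quot i g (upd z j c)) holomorphic_on ball 0 R"
    proof (cases "j = i")
      case True then show ?thesis using qh[OF z] by simp
    next
      case ji: False
      have nz: "(\<lambda>c. diff_quot i g (upd (upd z i a) j c)) holomorphic_on ball 0 R"
        if a: "a \<noteq> 0" "cmod a < R" for a
      proof -
        have "(\<lambda>c. (g (upd (upd z i a) j c) - g (upd (upd z i 0) j c)) / a) holomorphic_on ball 0 R"
          using R a by (intro holomorphic_intros h upd_polydisc[OF z]) auto
        then show ?thesis
          using ji a(1) by (simp add: diff_quot_def upd_commute[of j i])
      qed
      show ?thesis
      proof (cases "z $ i = 0")
        case False
        then show ?thesis using nz[of "z $ i"] z by (simp add: polydisc_def)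
      next
        case True
        \<comment> \<open>The shift by 2 instead of 1 keeps \<open>t 0\<close> strictly inside the
          disc of radius \<open>R\<close>.\<close>
        define t where "t n = complex_of_real (R / real (n + 2))" for n
        have t: "t n \<noteq> 0" "cmod (t n) < R" for n
        proof -
          have "R < R * real (n + 2)" using R by simp
          then show "t n \<noteq> 0" "cmod (t n) < R"
            using R unfolding t_def norm_of_real of_real_eq_0_iff by (auto simp: field_simps)
        qed
        have zi: "upd z i 0 = z" using True by (auto simp: vec_eq_iff)
        have K: "\<bar>2 * (2 * M / R) / R\<bar> * (R / real (n + 2)) \<ge> cmod (diff_quot i g (upd (upd z i (t n)) j c)
            - diff_quot i g (upd z j c))" if c: "c \<in> ball 0 R" for n c
        proof -
          have "cmod (diff_quot i g (upd (upd z j c) i (t n)) - diff_quot i g (upd (upd z j c) i 0))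
              \<le> 2 * (2 * M / R) / R * cmod (t n)"
            using t[of n] c by (intro lip upd_polydisc[OF z]) auto
          also have "\<dots> \<le> \<bar>2 * (2 * M / R) / R\<bar> * cmod (t n)"
            by (intro mult_right_mono abs_ge_self norm_ge_zero)
          also have "cmod (t n) = R / real (n + 2)" using R unfolding t_def norm_of_real by simp
          finally show ?thesis
            using ji upd_commute[of j i z c] zi by simp
        qed
        have tl: "(\<lambda>n. \<bar>2 * (2 * M / R) / R\<bar> * (R / real (n + 2))) \<longlonglongrightarrow> 0"
          by real_asymp
        have "uniform_limit (ball 0 R) (\<lambda>n c. diff_quot i g (upd (upd z i (t n)) j c))
                (\<lambda>c. diff_quot i g (upd z j c)) sequentially"
          unfolding uniform_limit_iff
        proof (intro allI impI)
          fix e :: real assume "0 < e"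
          with tl have "\<forall>\<^sub>F n in sequentially. \<bar>2 * (2 * M / R) / R\<bar> * (R / real (n + 2)) < e"
            by (rule order_tendstoD)
          then show "\<forall>\<^sub>F n in sequentially. \<forall>c\<in>ball 0 R.
              dist (diff_quot i g (upd (upd z i (t n)) j c)) (diff_quot i g (upd z j c)) < e"
          proof eventually_elim
            case (elim n)
            show ?case
            proof
              fix c :: complex assume "c \<in> ball 0 R"
              from K[OF this, of n] elim
              show "dist (diff_quot i g (upd (upd z i (t n)) j c)) (diff_quot i g (upd z j c)) < e"
                unfolding dist_norm by linarith
            qed
          qed
        qed
        then have ul: "uniform_limit A (\<lambda>n c. diff_quot i g (upd (upd z i (t n)) j c))
                (\<lambda>c. diff_quot i g (upd z j c)) sequentially" if "A \<subseteq> ball 0 R" for A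
          using that by (rule uniform_limit_on_subset)
        show ?thesis
        proof (rule holomorphic_uniform_sequence[OF open_ball nz[OF t]])
          fix x :: complex assume "x \<in> ball 0 R"
          then obtain d where "0 < d" "cball x d \<subseteq> ball 0 R"
            by (meson open_ball open_contains_cball)
          then show "\<exists>d>0. cball x d \<subseteq> ball 0 R \<and>
              uniform_limit (cball x d) (\<lambda>n c. diff_quot i g (upd (upd z i (t n)) j c))
                (\<lambda>c. diff_quot i g (upd z j c)) sequentially" using ul by blast
        qed
      qed
    qed
  qed
qed

lemma bounded_sep_holo_upd_zero:
  assumes "bounded_sep_holo R M g" and "0 < R"
  shows "bounded_sep_holo R M (\<lambda>z. g (upd z i 0))"
  unfolding bounded_sep_holo_def
proof (intro ballI conjI allI)
  fix z :: "complex^'a" and j assume z: "z \<in> polydisc R"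
  then have z0: "upd z i 0 \<in> polydisc R" using assms(2) by (intro upd_polydisc) auto
  then show "cmod (g (upd z i 0)) \<le> M" using assms(1) by (auto simp: bounded_sep_holo_def)
  show "(\<lambda>c. g (upd (upd z j c) i 0)) holomorphic_on ball 0 R"
  proof (cases "i = j")
    case False
    then show ?thesis
      using z0 assms(1) by (subst upd_commute) (auto simp: bounded_sep_holo_def)
  qed simp
qed

lemma bounded_sep_holo_iterate:
  assumes "bounded_sep_holo R M g" and "0 < R"
  shows "bounded_sep_holo R ((2 / R) ^ k * M) ((diff_quot i ^^ k) g)"
proof (induction k)
  case (Suc k)
  then show ?case using bounded_sep_holo_diff_quot[OF Suc assms(2)] by (simp add: mult.assoc)
qed (use assms in simp)

lemma diff_quot_expansion:
  "g z = (\<Sum>k<K. (diff_quot i ^^ k) g (upd z i 0) * z $ i ^ k) + z $ i ^ K * (diff_quot i ^^ K) g z"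
proof (induction K)
  case (Suc K)
  have "h z = h (upd z i 0) + z $ i * diff_quot i h z" for h
  proof (cases "z $ i = 0")
    case True
    then have "upd z i 0 = z" by (auto simp: vec_eq_iff)
    then show ?thesis using True by simp
  qed (simp add: diff_quot_def)
  from this[of "(diff_quot i ^^ K) g"] show ?case
    by (subst Suc) (simp add: algebra_simps)
qed simp

text \<open>Each quotient costs a factor \<open>2 / R\<close>, so the \<open>k\<close>-th term is at
  most \<open>M * x ^ k\<close> with \<open>x = 2 / R * cmod (z $ i)\<close>. This is where the
  radius \<open>R / 2\<close> comes from.\<close>

lemma diff_quot_has_sum:
  assumes g: "bounded_sep_holo R M g" and R: "0 < R" and z: "z \<in> polydisc (R / 2)"
  shows "((\<lambda>k. (diff_quot i ^^ k) g (upd z i 0) * z $ i ^ k) has_sum g z) UNIV"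
proof (rule norm_summable_imp_has_sum)
  define x where "x = 2 / R * cmod (z $ i)"
  have x: "0 \<le> x" "x < 1" using z R by (auto simp: x_def polydisc_def field_simps)
  have z': "z \<in> polydisc R" "upd z i 0 \<in> polydisc R"
  proof -
    have "cmod (z $ l) < R" for l using z R by (auto simp: polydisc_def dest!: spec[of _ l])
    then show "z \<in> polydisc R" "upd z i 0 \<in> polydisc R" using R by (auto simp: polydisc_def)
  qed
  have bd: "cmod ((diff_quot i ^^ k) g y) * cmod (z $ i) ^ k \<le> M * x ^ k" if "y \<in> polydisc R" for y k
  proof -
    have "cmod ((diff_quot i ^^ k) g y) \<le> (2 / R) ^ k * M"
      using bounded_sep_holo_iterate[OF g R] that by (auto simp: bounded_sep_holo_def)
    then have "cmod ((diff_quot i ^^ k) g y) * cmod (z $ i) ^ k \<le> (2 / R) ^ k * M * cmod (z $ i) ^ k"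
      by (intro mult_right_mono) auto
    then show ?thesis by (simp only: x_def power_mult_distrib mult_ac)
  qed
  have s: "summable (\<lambda>k. M * x ^ k)" using x by (intro summable_mult summable_geometric) auto
  show "summable (\<lambda>k. norm ((diff_quot i ^^ k) g (upd z i 0) * z $ i ^ k))"
    by (rule summable_comparison_test'[OF s]) (use bd[OF z'(2)] in \<open>simp add: norm_mult norm_power\<close>)
  have "(\<lambda>K. z $ i ^ K * (diff_quot i ^^ K) g z) \<longlonglongrightarrow> 0"
    by (rule Lim_null_comparison[OF _ summable_LIMSEQ_zero[OF s]])
      (use bd[OF z'(1)] in \<open>auto simp: norm_mult norm_power mult.commute\<close>)
  then have "(\<lambda>K. g z - z $ i ^ K * (diff_quot i ^^ K) g z) \<longlonglongrightarrow> g z - 0"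
    by (intro tendsto_intros)
  moreover have "g z - z $ i ^ K * (diff_quot i ^^ K) g z =
      (\<Sum>k<K. (diff_quot i ^^ k) g (upd z i 0) * z $ i ^ k)" for K
    by (subst diff_quot_expansion[where g=g and z=z and i=i and K=K]) simp
  ultimately
  show "(\<lambda>k. (diff_quot i ^^ k) g (upd z i 0) * z $ i ^ k) sums g z"
    by (simp add: sums_def)
qed

section \<open>Multivariate Taylor expansion\<close>

lemma total_deg_upd:
  fixes \<beta> :: "nat^'n::finite"
  shows "\<beta> $ i = 0 \<Longrightarrow> total_deg (upd \<beta> i k) = k + total_deg \<beta>"
  unfolding total_deg_def by (simp add: sum.remove[of UNIV i])

lemma monomial_upd:
  fixes \<beta> :: "nat^'n::finite"
  shows "\<beta> $ i = 0 \<Longrightarrow> monomial (upd \<beta> i k) z = z $ i ^ k * monomial \<beta> z"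
  unfolding monomial_def by (simp add: prod.remove[of UNIV i])

lemma norm_monomial: "cmod (monomial \<beta> z) = (\<Prod>l\<in>UNIV. cmod (z $ l) ^ (\<beta> $ l))"
  by (simp add: monomial_def prod_norm[symmetric] norm_power)

lemma monomial_scale: "monomial \<beta> (c *s z) = c ^ total_deg \<beta> * monomial \<beta> z"
  by (simp add: monomial_def total_deg_def power_mult_distrib prod.distrib power_sum)

text \<open>Finitely many exponents lie in a box, over which the sum factors into partial geometric
  sums.\<close>

lemma summable_monomials:
  assumes z: "z \<in> polydisc 1"
  shows "(\<lambda>\<beta>. cmod (monomial \<beta> z)) summable_on UNIV"
proof (rule nonneg_bdd_above_summable_on)
  have "(\<Sum>\<beta>\<in>F. cmod (monomial \<beta> z)) \<le> (\<Prod>l\<in>UNIV. 1 / (1 - cmod (z $ l)))" if F: "finite F" for F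
  proof -
    define N where "N = (\<Sum>\<beta>\<in>F. total_deg \<beta>)"
    have N: "\<beta> $ l \<le> N" if "\<beta> \<in> F" for \<beta> l
    proof -
      have "\<beta> $ l \<le> total_deg \<beta>" unfolding total_deg_def by (rule member_le_sum) auto
      also have "\<dots> \<le> N" unfolding N_def using that F by (intro member_le_sum) auto
      finally show ?thesis .
    qed
    have "(\<Sum>\<beta>\<in>F. cmod (monomial \<beta> z)) =
        (\<Sum>b\<in>vec_nth ` F. \<Prod>l\<in>UNIV. cmod (z $ l) ^ b l)"
      by (subst sum.reindex) (auto simp: inj_on_def vec_nth_inject norm_monomial)
    also have "\<dots> \<le> (\<Sum>b\<in>PiE UNIV (\<lambda>_. {..N}). \<Prod>l\<in>UNIV. cmod (z $ l) ^ b l)"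
      using N by (intro sum_mono2 prod_nonneg finite_PiE) auto
    also have "\<dots> = (\<Prod>l\<in>UNIV. \<Sum>k\<le>N. cmod (z $ l) ^ k)"
      by (rule prod_sum_PiE[symmetric]) auto
    also have "\<dots> \<le> (\<Prod>l\<in>UNIV. 1 / (1 - cmod (z $ l)))"
    proof (intro prod_mono conjI sum_nonneg)
      fix l
      have "cmod (z $ l) < 1" using z by (auto simp: polydisc_def)
      then have "(\<lambda>k. cmod (z $ l) ^ k) sums (1 / (1 - cmod (z $ l)))" by (intro geometric_sums) auto
      then show "(\<Sum>k\<le>N. cmod (z $ l) ^ k) \<le> 1 / (1 - cmod (z $ l))"
        by (metis sum_le_suminf finite_atMost sums_unique sums_summable zero_le_power norm_ge_zero)
    qed auto
    finally show ?thesis .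
  qed
  then show "bdd_above (sum (\<lambda>\<beta>. cmod (monomial \<beta> z)) ` {F. F \<subseteq> UNIV \<and> finite F})"
    by (auto simp: bdd_above_def)
qed auto

text \<open>Records which variables have already been expanded. For \<open>I = UNIV\<close> it says
  that a coefficient is constant, which ends the induction below.\<close>

definition indep_of :: "'n set \<Rightarrow> ('a^'n \<Rightarrow> 'b) \<Rightarrow> bool" where
  "indep_of I h \<longleftrightarrow> (\<forall>z z'. (\<forall>l. l \<notin> I \<longrightarrow> z $ l = z' $ l) \<longrightarrow> h z = h z')"

lemma indep_ofD: "indep_of I h \<Longrightarrow> (\<And>l. l \<notin> I \<Longrightarrow> z $ l = z' $ l) \<Longrightarrow> h z = h z'"
  by (auto simp: indep_of_def)

lemma indep_of_diff_quot:
  fixes h :: "complex^'n::finite \<Rightarrow> complex"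
  assumes "indep_of I h" "i \<notin> I"
  shows "indep_of I (diff_quot i h)"
  unfolding indep_of_def
proof (intro allI impI)
  fix z z' :: "complex^'n" assume e: "\<forall>l. l \<notin> I \<longrightarrow> z $ l = z' $ l"
  have "h (upd z i c) = h (upd z' i c)" for c
    by (rule indep_ofD[OF assms(1)]) (use e in auto)
  moreover have "h z = h z'" by (rule indep_ofD[OF assms(1)]) (use e in auto)
  moreover have "z $ i = z' $ i" using e assms by auto
  ultimately show "diff_quot i h z = diff_quot i h z'" by (simp add: diff_quot_def)
qed

lemma indep_of_iterate_upd:
  assumes "indep_of I h" "i \<notin> I"
  shows "indep_of (insert i I) (\<lambda>z. (diff_quot i ^^ k) h (upd z i 0))"
proof -
  have *: "indep_of I ((diff_quot i ^^ k) h)"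
    by (induction k) (use assms indep_of_diff_quot in auto)
  show ?thesis unfolding indep_of_def by (intro allI impI indep_ofD[OF *]) auto
qed

text \<open>Induction over the set of expanded variables, with coefficients that are still functions
  of the remaining ones. Expanding every coefficient in one more variable gives an iterated sum; the
  bound by the total degree is carried along in order to turn it into a single unordered
  sum.\<close>

lemma partial_expansion:
  assumes "finite I" and g: "bounded_sep_holo R M (g :: complex^'n::finite \<Rightarrow> complex)" and R: "0 < R"
  shows "\<exists>c. (\<forall>\<beta>. (\<forall>l. l \<notin> I \<longrightarrow> \<beta> $ l = 0) \<longrightarrow>
              bounded_sep_holo R ((2 / R) ^ total_deg \<beta> * M) (c \<beta>) \<and> indep_of I (c \<beta>)) \<and>
           (\<forall>z\<in>polydisc (R / 2).
              ((\<lambda>\<beta>. c \<beta> z * monomial \<beta> z) has_sum g z) {\<beta>. \<forall>l. l \<notin> I \<longrightarrow> \<beta> $ l = 0})"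
  using \<open>finite I\<close>
proof induction
  case empty
  have s: "{\<beta>::nat^'n. \<forall>l. \<beta> $ l = 0} = {0}" by (auto simp: vec_eq_iff)
  have i: "indep_of {} g"
    unfolding indep_of_def by (metis empty_iff vec_eq_iff)
  show ?case
  proof (intro exI[of _ "\<lambda>_. g"] conjI allI impI ballI)
    show "bounded_sep_holo R ((2 / R) ^ total_deg \<beta> * M) g" if "\<forall>l. l \<notin> {} \<longrightarrow> \<beta> $ l = 0" for \<beta> :: "nat^'n"
      using that g by (simp add: total_deg_def)
    show "((\<lambda>\<beta>. g z * monomial \<beta> z) has_sum g z) {\<beta>. \<forall>l. l \<notin> {} \<longrightarrow> \<beta> $ l = 0}" for z
      using has_sum_finite[of "{0::nat^'n}" "\<lambda>\<beta>. g z * monomial \<beta> z"] s by (simp add: monomial_def)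
  qed (rule i)
next
  case (insert i I)
  let ?S = "\<lambda>I. {\<beta>::nat^'n. \<forall>l. l \<notin> I \<longrightarrow> \<beta> $ l = 0}"
  obtain c where c: "\<And>\<beta>. \<beta> \<in> ?S I \<Longrightarrow> bounded_sep_holo R ((2 / R) ^ total_deg \<beta> * M) (c \<beta>)"
    "\<And>\<beta>. \<beta> \<in> ?S I \<Longrightarrow> indep_of I (c \<beta>)"
    "\<And>z. z \<in> polydisc (R / 2) \<Longrightarrow> ((\<lambda>\<beta>. c \<beta> z * monomial \<beta> z) has_sum g z) (?S I)"
    using insert.IH by auto
  define d where "d \<beta> z = (diff_quot i ^^ (\<beta> $ i)) (c (upd \<beta> i 0)) (upd z i 0)" for \<beta> z
  have S0: "upd \<beta> i 0 \<in> ?S I" if "\<beta> \<in> ?S (insert i I)" for \<beta> using that by auto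
  have d1: "bounded_sep_holo R ((2 / R) ^ total_deg \<beta> * M) (d \<beta>)" if "\<beta> \<in> ?S (insert i I)" for \<beta>
  proof -
    have "total_deg \<beta> = \<beta> $ i + total_deg (upd \<beta> i 0)"
      using total_deg_upd[of "upd \<beta> i 0" i "\<beta> $ i"] by simp
    then show ?thesis
      using bounded_sep_holo_upd_zero[OF bounded_sep_holo_iterate[OF c(1)[OF S0[OF that]] R, of "\<beta> $ i" i] R, of i]
      unfolding d_def[abs_def] by (simp add: power_add mult_ac)
  qed
  have d2: "indep_of (insert i I) (d \<beta>)" if "\<beta> \<in> ?S (insert i I)" for \<beta>
    using indep_of_iterate_upd[OF c(2)[OF S0[OF that]] insert.hyps(2)] unfolding d_def[abs_def] .
  have d3: "((\<lambda>\<beta>. d \<beta> z * monomial \<beta> z) has_sum g z) (?S (insert i I))" if z: "z \<in> polydisc (R / 2)" for z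
  proof -
    have zR: "z \<in> polydisc R"
      using z R by (auto simp: polydisc_def intro: less_le_trans[of _ "R / 2"])
    \<comment> \<open>Absolute convergence by comparison with the monomials at \<open>2 / R\<close>
      times \<open>z\<close>, a point of the unit polydisc. It licenses the regrouping over pairs
      below.\<close>
    have sm: "(\<lambda>\<beta>. d \<beta> z * monomial \<beta> z) summable_on ?S (insert i I)"
    proof (rule abs_summable_summable, rule Infinite_Sum.abs_summable_on_comparison_test')
      have "(complex_of_real (2 / R)) *s z \<in> polydisc 1"
        using z R by (auto simp: polydisc_def norm_mult norm_divide field_simps)
      then show "(\<lambda>\<beta>. cmod (monomial \<beta> ((complex_of_real (2 / R)) *s z)) * M) summable_on ?S (insert i I)"
        using summable_on_subset_banach[OF summable_monomials] by (intro summable_on_cmult_left) auto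
    next
      fix \<beta> :: "nat^'n" assume "\<beta> \<in> ?S (insert i I)"
      then have "cmod (d \<beta> z) \<le> (2 / R) ^ total_deg \<beta> * M"
        using d1 zR by (auto simp: bounded_sep_holo_def)
      then show "norm (d \<beta> z * monomial \<beta> z) \<le> cmod (monomial \<beta> ((complex_of_real (2 / R)) *s z)) * M"
        using R mult_right_mono[of "cmod (d \<beta> z)" "(2 / R) ^ total_deg \<beta> * M" "cmod (monomial \<beta> z)"]
        by (simp add: monomial_scale norm_mult norm_power norm_divide mult_ac)
    qed
    \<comment> \<open>Exponents supported on \<open>insert i I\<close> correspond to pairs of one
      supported on \<open>I\<close> and the new exponent of variable \<open>i\<close>.\<close>
    define u where "u p = upd (fst p) i (snd p)" for p :: "(nat^'n) \<times> nat"
    have bij: "bij_betw u (Sigma (?S I) (\<lambda>_. UNIV)) (?S (insert i I))"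
    proof (rule bij_betw_byWitness[where f' = "\<lambda>\<beta>. (upd \<beta> i 0, \<beta> $ i)"])
      show "\<forall>a\<in>?S I \<times> UNIV. (upd (u a) i 0, u a $ i) = a"
      proof
        fix a assume a: "a \<in> ?S I \<times> (UNIV :: nat set)"
        then have "upd (fst a) i 0 = fst a" using insert.hyps(2) by (auto simp: vec_eq_iff)
        then show "(upd (u a) i 0, u a $ i) = a" by (simp add: u_def)
      qed
    qed (use insert.hyps in \<open>auto simp: u_def split: if_splits\<close>)
    have "((\<lambda>p. d (u p) z * monomial (u p) z) has_sum g z) (Sigma (?S I) (\<lambda>_. UNIV))"
    proof (rule has_sum_SigmaI[OF _ c(3)[OF z]])
      show "(\<lambda>p. d (u p) z * monomial (u p) z) summable_on ?S I \<times> UNIV"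
        using sm summable_on_reindex_bij_betw[OF bij, of "\<lambda>\<beta>. d \<beta> z * monomial \<beta> z"] by simp
      fix \<beta> :: "nat^'n" assume b: "\<beta> \<in> ?S I"
      then have bi: "\<beta> $ i = 0" and bu: "upd \<beta> i 0 = \<beta>" using insert.hyps(2) by (auto simp: vec_eq_iff)
      have "((\<lambda>k. (diff_quot i ^^ k) (c \<beta>) (upd z i 0) * z $ i ^ k * monomial \<beta> z)
          has_sum c \<beta> z * monomial \<beta> z) UNIV"
        by (intro has_sum_cmult_left diff_quot_has_sum[OF c(1)[OF b] R z])
      then show "((\<lambda>k. d (u (\<beta>, k)) z * monomial (u (\<beta>, k)) z) has_sum c \<beta> z * monomial \<beta> z) UNIV"
        using bi bu by (simp add: u_def d_def monomial_upd mult.assoc)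
    qed
    then show ?thesis using has_sum_reindex_bij_betw[OF bij, of "\<lambda>\<beta>. d \<beta> z * monomial \<beta> z"] by simp
  qed
  show ?case using d1 d2 d3 by (intro exI[of _ d]) auto
qed

lemma holo_on_bounded_sep_holo:
  fixes g :: "complex^'n::finite \<Rightarrow> complex"
  assumes g: "holo_on S g" and S: "open S" "0 \<in> S"
  obtains R M where "0 < R" "bounded_sep_holo R M g"
proof -
  obtain e where e: "0 < e" "cball 0 e \<subseteq> S" using S open_contains_cball by blast
  have cont: "continuous_on S g"
    using g by (auto simp: holo_on_def continuous_on_eq_continuous_at[OF S(1)] dest: has_derivative_continuous)
  then have "compact (g ` cball 0 e)"
    using e by (intro compact_continuous_image continuous_on_subset[OF cont]) auto
  then obtain M where M: "\<And>z. z \<in> cball 0 e \<Longrightarrow> cmod (g z) \<le> M"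
    by (meson bounded_iff compact_imp_bounded imageI)
  \<comment> \<open>The Euclidean norm is at most the sum of the coordinate moduli, so the polydisc
    of this radius fits into the ball of radius \<open>e\<close>.\<close>
  define R where "R = e / CARD('n)"
  have R: "0 < R" using e by (simp add: R_def)
  have sub: "polydisc R \<subseteq> cball (0::complex^'n) e"
  proof
    fix z :: "complex^'n" assume "z \<in> polydisc R"
    then have "cmod (z $ l) \<le> R" for l by (auto simp: polydisc_def less_imp_le)
    then have "norm z \<le> (\<Sum>l\<in>(UNIV::'n set). R)"
      unfolding norm_vec_def by (intro order_trans[OF L2_set_le_sum] sum_mono) auto
    then show "z \<in> cball 0 e" by (simp add: R_def)
  qed
  have "(\<lambda>c. g (upd z i c)) holomorphic_on ball 0 R" if z: "z \<in> polydisc R" for z i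
  proof (rule holomorphic_onI)
    fix c :: complex assume "c \<in> ball 0 R"
    then have "upd z i c \<in> S" using upd_polydisc[OF z] sub e by auto
    then obtain D where D: "(g has_derivative D) (at (upd z i c))" "\<And>c v. D (c *s v) = c * D v"
      using g by (auto simp: holo_on_def)
    have u: "upd z i c = upd z i 0 + c *s axis i 1" for c
      by (auto simp: vec_eq_iff axis_def)
    have "bounded_linear (\<lambda>c::complex. c *s (axis i 1 :: complex^'n))"
      by (intro linear_conv_bounded_linear[THEN iffD1] linearI) (auto simp: vec_eq_iff algebra_simps)
    then have "((\<lambda>c. upd z i 0 + c *s axis i 1) has_derivative (\<lambda>c. c *s axis i 1)) (at c)"
      by (auto intro!: derivative_eq_intros bounded_linear_imp_has_derivative)
    then have "((\<lambda>c. upd z i c) has_derivative (\<lambda>c. c *s axis i 1)) (at c)"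
      by (simp only: u[symmetric])
    from has_derivative_compose[OF this D(1)]
    have "((\<lambda>c. g (upd z i c)) has_field_derivative D (axis i 1)) (at c)"
      by (simp add: D(2) has_field_derivative_def mult.commute[of _ "D _"])
    then show "(\<lambda>c. g (upd z i c)) field_differentiable at c within ball 0 R"
      using field_differentiable_def has_field_derivative_at_within by blast
  qed
  then have "bounded_sep_holo R M g" using M sub by (auto simp: bounded_sep_holo_def)
  with R that show thesis by blast
qed

lemma holo_on_has_taylor:
  fixes g :: "complex^'n::finite \<Rightarrow> complex"
  assumes "holo_on S g" and "open S" "0 \<in> S"
  shows "\<exists>a. \<forall>\<^sub>F z in nhds 0. ((\<lambda>\<alpha>. a \<alpha> * monomial \<alpha> z) has_sum g z) UNIV"
proof -
  obtain R M where R: "0 < R" and g: "bounded_sep_holo R M g"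
    using holo_on_bounded_sep_holo[OF assms] .
  obtain c where c: "\<And>\<beta>. indep_of UNIV (c \<beta>)"
    "\<And>z. z \<in> polydisc (R / 2) \<Longrightarrow> ((\<lambda>\<beta>. c \<beta> z * monomial \<beta> z) has_sum g z) UNIV"
    using partial_expansion[where I = UNIV, OF finite g R] by auto
  have "(\<lambda>\<beta>. c \<beta> z * monomial \<beta> z) = (\<lambda>\<beta>. c \<beta> 0 * monomial \<beta> z)" for z
    using indep_ofD[OF c(1), of z 0] by auto
  then have h: "((\<lambda>\<beta>. c \<beta> 0 * monomial \<beta> z) has_sum g z) UNIV" if "z \<in> polydisc (R / 2)" for z
    using c(2)[OF that] by (simp only:)
  have "\<forall>\<^sub>F z in nhds 0. z \<in> ball (0::complex^'n) (R / 2)"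
    using R by (intro eventually_nhds_in_open) auto
  then have "\<forall>\<^sub>F z in nhds 0. z \<in> (polydisc (R / 2) :: (complex^'n) set)"
    unfolding polydisc_def mem_Collect_eq mem_ball_0
    by eventually_elim (blast intro: le_less_trans Finite_Cartesian_Product.norm_nth_le)
  then have "\<forall>\<^sub>F z in nhds 0. ((\<lambda>\<beta>. c \<beta> 0 * monomial \<beta> z) has_sum g z) UNIV"
    by eventually_elim (rule h)
  then show ?thesis by (rule exI[of _ "\<lambda>\<beta>. c \<beta> 0"])
qed

section \<open>The leading homogeneous part\<close>

lemma finite_vec_set: "finite S \<Longrightarrow> finite {\<alpha>::'a^'n::finite. \<forall>l. \<alpha> $ l \<in> S}"
proof -
  assume "finite S"
  then have "finite ((\<lambda>f. \<chi> l. f l) ` PiE (UNIV::'n set) (\<lambda>_. S) :: ('a^'n) set)"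
    by (intro finite_imageI finite_PiE) auto
  moreover have "{\<alpha>::'a^'n. \<forall>l. \<alpha> $ l \<in> S} \<subseteq> (\<lambda>f. \<chi> l. f l) ` PiE (UNIV::'n set) (\<lambda>_. S)"
  proof
    fix \<alpha> :: "'a^'n" assume "\<alpha> \<in> {\<alpha>. \<forall>l. \<alpha> $ l \<in> S}"
    then show "\<alpha> \<in> (\<lambda>f. \<chi> l. f l) ` PiE (UNIV::'n set) (\<lambda>_. S)"
      by (intro image_eqI[of _ _ "vec_nth \<alpha>"]) auto
  qed
  ultimately show ?thesis by (rule rev_finite_subset)
qed

lemma finite_total_deg: "finite {\<alpha>::nat^'n::finite. total_deg \<alpha> = m}"
proof (rule finite_subset[OF _ finite_vec_set[of "{..m}"]])
  show "{\<alpha>::nat^'n. total_deg \<alpha> = m} \<subseteq> {\<alpha>. \<forall>l. \<alpha> $ l \<in> {..m}}"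
    by (auto simp: total_deg_def intro: member_le_sum)
qed auto

lemma tendsto_monomial [tendsto_intros]:
  "(f \<longlongrightarrow> z) F \<Longrightarrow> ((\<lambda>x. monomial \<alpha> (f x)) \<longlongrightarrow> monomial \<alpha> z) F"
  unfolding monomial_def by (intro tendsto_intros)

lemma monomial_mult:
  "monomial \<alpha> (\<chi> l. y $ l * z $ l) = monomial \<alpha> y * monomial \<alpha> z"
  by (simp add: monomial_def power_mult_distrib prod.distrib)

text \<open>Artin's argument for the linear independence of characters.\<close>
lemma monomials_independent:
  assumes "finite F" and "\<And>z. (\<Sum>\<alpha>\<in>F. a \<alpha> * monomial \<alpha> z) = 0" and "\<alpha> \<in> F"
  shows "a \<alpha> = 0"
  using assms
proof (induction F arbitrary: a \<alpha> rule: finite_induct)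
  case (insert \<beta> F)
  have *: "a \<gamma> = 0" if "\<gamma> \<in> F" for \<gamma>
  proof -
    have "\<gamma> \<noteq> \<beta>" using that insert.hyps by auto
    then obtain i where i: "\<gamma> $ i \<noteq> \<beta> $ i" by (auto simp: vec_eq_iff)
    define y :: "complex^'a" where "y = (\<chi> l. if l = i then 2 else 1)"
    have y: "monomial \<delta> y = 2 ^ (\<delta> $ i)" for \<delta>
    proof -
      have "monomial \<delta> y = (\<Prod>l\<in>UNIV. if l = i then 2 ^ (\<delta> $ l) else 1)"
        unfolding monomial_def y_def by (intro prod.cong) auto
      then show ?thesis by simp
    qed
    have "(\<Sum>\<delta>\<in>F. (a \<delta> * (monomial \<delta> y - monomial \<beta> y)) * monomial \<delta> z) = 0" for z
    proof -
      have "(\<Sum>\<delta>\<in>insert \<beta> F. (a \<delta> * (monomial \<delta> y - monomial \<beta> y)) * monomial \<delta> z) =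
         (\<Sum>\<delta>\<in>insert \<beta> F. a \<delta> * monomial \<delta> (\<chi> l. y $ l * z $ l)) -
         monomial \<beta> y * (\<Sum>\<delta>\<in>insert \<beta> F. a \<delta> * monomial \<delta> z)"
        unfolding sum_distrib_left sum_subtractf[symmetric] monomial_mult
        by (intro sum.cong) (auto simp: algebra_simps)
      then show ?thesis using insert.hyps insert.prems(1) by simp
    qed
    from insert.IH[OF this that] have "a \<gamma> * (monomial \<gamma> y - monomial \<beta> y) = 0" .
    moreover have "monomial \<gamma> y \<noteq> monomial \<beta> y"
    proof
      assume "monomial \<gamma> y = monomial \<beta> y"
      then have "cmod (monomial \<gamma> y) = cmod (monomial \<beta> y)" by simp
      then show False using i by (simp add: y norm_power power_inject_exp)
    qed
    ultimately show ?thesis by simp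
  qed
  moreover have "a \<beta> = 0"
    using insert.prems(1)[of 1] insert.hyps * by (simp add: monomial_def)
  ultimately show ?case using insert.prems(2) by auto
qed simp

definition hom_sum :: "(nat^'n \<Rightarrow> complex) \<Rightarrow> nat \<Rightarrow> complex^'n::finite \<Rightarrow> complex" where
  "hom_sum a m z = (\<Sum>\<alpha> | total_deg \<alpha> = m. a \<alpha> * monomial \<alpha> z)"

lemma hom_sum_scale: "hom_sum a m (c *s z) = c ^ m * hom_sum a m z"
  unfolding hom_sum_def sum_distrib_left by (intro sum.cong) (auto simp: monomial_scale)

lemma tendsto_hom_sum [tendsto_intros]:
  "(f \<longlongrightarrow> z) F \<Longrightarrow> ((\<lambda>x. hom_sum a m (f x)) \<longlongrightarrow> hom_sum a m z) F"
  unfolding hom_sum_def by (intro tendsto_intros)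

lemma hom_part_eq: "hom_part g = hom_sum (taylor_coeffs g) (vanishing_order g)"
  by (simp add: fun_eq_iff hom_part_def hom_sum_def)

text \<open>The series converges absolutely at the point with all coordinates \<open>r\<close>.
  Passing to \<open>w\<close> of norm \<open>t * r\<close> with \<open>t \<le> 1\<close> gains
  \<open>t ^ Suc m\<close> on every term of degree above \<open>m\<close>, and the terms below
  \<open>m\<close> vanish.\<close>

lemma taylor_remainder:
  fixes g :: "complex^'n::finite \<Rightarrow> complex"
  assumes a: "\<forall>\<^sub>F z in nhds 0. ((\<lambda>\<alpha>. a \<alpha> * monomial \<alpha> z) has_sum g z) UNIV"
    and m: "\<And>\<alpha>. total_deg \<alpha> < m \<Longrightarrow> a \<alpha> = 0"
  shows "\<exists>C r. 0 < r \<and> (\<forall>w. norm w \<le> r \<longrightarrow> cmod (g w - hom_sum a m w) \<le> C * norm w ^ Suc m)"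
proof -
  obtain d where d: "0 < d" "\<And>z. norm z < d \<Longrightarrow> ((\<lambda>\<alpha>. a \<alpha> * monomial \<alpha> z) has_sum g z) UNIV"
    using a by (auto simp: eventually_nhds_metric dist_norm)
  \<comment> \<open>With this choice the point \<open>y\<close>, all of whose coordinates are
    \<open>r\<close>, has norm at most \<open>d / 2\<close>.\<close>
  define r where "r = d / (2 * CARD('n))"
  have r: "0 < r" using d(1) by (simp add: r_def)
  have "r \<le> d / 2" using d(1) by (simp add: r_def field_simps)
  then have rd: "r < d" using d(1) by simp
  define y :: "complex^'n" where "y = (\<chi> l. of_real r)"
  have "norm y \<le> (\<Sum>l\<in>(UNIV::'n set). r)"
    unfolding norm_vec_def by (intro order_trans[OF L2_set_le_sum] sum_mono) (use r in \<open>auto simp: y_def\<close>)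
  also have "\<dots> < d" using d(1) by (simp add: r_def)
  finally have "norm y < d" .
  from summable_on_iff_abs_summable_on_complex[THEN iffD1, OF has_sum_imp_summable[OF d(2)[OF this]]]
  have "(\<lambda>\<alpha>. norm (a \<alpha> * monomial \<alpha> y)) summable_on UNIV" .
  moreover have "norm (a \<alpha> * monomial \<alpha> y) = cmod (a \<alpha>) * r ^ total_deg \<alpha>" for \<alpha>
    using r by (simp add: norm_mult norm_monomial y_def total_deg_def power_sum)
  ultimately have S: "(\<lambda>\<alpha>. cmod (a \<alpha>) * r ^ total_deg \<alpha>) summable_on UNIV" by simp
  define M where "M = infsum (\<lambda>\<alpha>. cmod (a \<alpha>) * r ^ total_deg \<alpha>) (UNIV - {\<alpha>. total_deg \<alpha> = m})"
  have HM: "((\<lambda>\<alpha>. cmod (a \<alpha>) * r ^ total_deg \<alpha>) has_sum M) (UNIV - {\<alpha>. total_deg \<alpha> = m})"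
    unfolding M_def by (rule has_sum_infsum[OF summable_on_subset_banach[OF S]]) auto
  have "cmod (g w - hom_sum a m w) \<le> M / r ^ Suc m * norm w ^ Suc m" if w: "norm w \<le> r" for w
  proof -
    define t where "t = norm w / r"
    have t: "0 \<le> t" "t \<le> 1" "norm w = t * r" using w r by (auto simp: t_def)
    have h1: "((\<lambda>\<alpha>. a \<alpha> * monomial \<alpha> w) has_sum (g w - hom_sum a m w)) (UNIV - {\<alpha>. total_deg \<alpha> = m})"
      unfolding hom_sum_def
      by (intro has_sum_Diff d(2) has_sum_finite finite_total_deg) (use w rd in auto)
    have h2: "((\<lambda>\<alpha>. t ^ Suc m * (cmod (a \<alpha>) * r ^ total_deg \<alpha>)) has_sum t ^ Suc m * M) (UNIV - {\<alpha>. total_deg \<alpha> = m})"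
      by (intro has_sum_cmult_right HM)
    have "norm (a \<alpha> * monomial \<alpha> w) \<le> t ^ Suc m * (cmod (a \<alpha>) * r ^ total_deg \<alpha>)"
      if "\<alpha> \<in> UNIV - {\<alpha>. total_deg \<alpha> = m}" for \<alpha>
    proof (cases "total_deg \<alpha> < m")
      case False
      then have k: "Suc m \<le> total_deg \<alpha>" using that by auto
      have "cmod (monomial \<alpha> w) \<le> (\<Prod>l\<in>UNIV. norm w ^ (\<alpha> $ l))"
        unfolding norm_monomial by (intro prod_mono conjI power_mono Finite_Cartesian_Product.norm_nth_le) auto
      also have "\<dots> = (t * r) ^ total_deg \<alpha>" by (simp add: total_deg_def power_sum t(3)[symmetric])
      also have "\<dots> \<le> t ^ Suc m * r ^ total_deg \<alpha>"
        unfolding power_mult_distrib using t r k by (intro mult_right_mono power_decreasing) auto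
      finally show ?thesis
        unfolding norm_mult using mult_left_mono[of "cmod (monomial \<alpha> w)" _ "cmod (a \<alpha>)"]
        by (metis mult.left_commute norm_ge_zero)
    qed (use m t r in auto)
    from norm_infsum_le[OF h1 h2 this] show ?thesis by (simp add: t_def power_divide field_simps)
  qed
  with r show ?thesis by blast
qed

text \<open>The direction is allowed to move with \<open>c\<close> for the sake of coordinate
  changes: such a map sends \<open>c *s \<xi>\<close> to \<open>c\<close> times a direction that
  only converges, so leading parts can be compared without composing power series.\<close>

lemma taylor_limit:
  fixes g :: "complex^'n::finite \<Rightarrow> complex"
  assumes a: "\<forall>\<^sub>F z in nhds 0. ((\<lambda>\<alpha>. a \<alpha> * monomial \<alpha> z) has_sum g z) UNIV"
    and m: "\<And>\<alpha>. total_deg \<alpha> < m \<Longrightarrow> a \<alpha> = 0"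
    and \<eta>: "(\<eta> \<longlongrightarrow> w) (at 0)"
  shows "((\<lambda>c. g (c *s \<eta> c) / c ^ m) \<longlongrightarrow> hom_sum a m w) (at 0)"
proof -
  obtain C r where r: "0 < r" and C: "\<And>w. norm w \<le> r \<Longrightarrow> cmod (g w - hom_sum a m w) \<le> C * norm w ^ Suc m"
    using taylor_remainder[of a g m] a m by blast
  have ns: "norm (c *s v) = cmod c * norm v" for c and v :: "complex^'n"
    by (simp add: norm_vec_def norm_mult L2_set_right_distrib)
  have "((\<lambda>c. cmod c * norm (\<eta> c)) \<longlongrightarrow> cmod 0 * norm w) (at 0)"
    by (intro tendsto_intros \<eta>)
  then have "\<forall>\<^sub>F c in at 0. cmod c * norm (\<eta> c) < r" using r by (intro order_tendstoD) auto
  then have ev: "\<forall>\<^sub>F c in at 0. norm (g (c *s \<eta> c) / c ^ m - hom_sum a m (\<eta> c)) \<le> C * (cmod c * norm (\<eta> c) ^ Suc m)"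
    using eventually_neq_at_within[of 0]
  proof eventually_elim
    case (elim c)
    have "cmod (g (c *s \<eta> c) - c ^ m * hom_sum a m (\<eta> c)) \<le> C * (cmod c * norm (\<eta> c)) ^ Suc m"
      using C[of "c *s \<eta> c"] elim by (simp add: ns hom_sum_scale)
    moreover have "g (c *s \<eta> c) / c ^ m - hom_sum a m (\<eta> c) = (g (c *s \<eta> c) - c ^ m * hom_sum a m (\<eta> c)) / c ^ m"
      using elim by (simp add: field_simps)
    ultimately show ?case using elim
      by (simp add: norm_divide norm_power divide_le_eq power_mult_distrib mult_ac)
  qed
  have "((\<lambda>c. C * (cmod c * norm (\<eta> c) ^ Suc m)) \<longlongrightarrow> C * (cmod 0 * norm w ^ Suc m)) (at 0)"
    by (intro tendsto_intros \<eta>)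
  then have "((\<lambda>c. C * (cmod c * norm (\<eta> c) ^ Suc m)) \<longlongrightarrow> 0) (at 0)" by simp
  from tendsto_add[OF Lim_null_comparison[OF ev this] tendsto_hom_sum[OF \<eta>, of a m]]
  show ?thesis by simp
qed

text \<open>The difference is an expansion of 0. Its lowest part is a limit of zeros, hence the zero
  polynomial, and independence of monomials gives a contradiction. This makes the \<open>THE\<close>
  in \<open>taylor_coeffs\<close> meaningful.\<close>

lemma taylor_unique:
  fixes g :: "complex^'n::finite \<Rightarrow> complex"
  assumes a: "\<forall>\<^sub>F z in nhds 0. ((\<lambda>\<alpha>. a \<alpha> * monomial \<alpha> z) has_sum g z) UNIV"
    and b: "\<forall>\<^sub>F z in nhds 0. ((\<lambda>\<alpha>. b \<alpha> * monomial \<alpha> z) has_sum g z) UNIV"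
  shows "a = b"
proof (rule ccontr)
  assume "a \<noteq> b"
  define d where "d \<alpha> = a \<alpha> - b \<alpha>" for \<alpha>
  define m where "m = (LEAST m. \<exists>\<alpha>. total_deg \<alpha> = m \<and> d \<alpha> \<noteq> 0)"
  have "\<exists>m \<alpha>. total_deg \<alpha> = m \<and> d \<alpha> \<noteq> 0" using \<open>a \<noteq> b\<close> by (auto simp: d_def)
  then have ex: "\<exists>\<alpha>. total_deg \<alpha> = m \<and> d \<alpha> \<noteq> 0" unfolding m_def by (rule LeastI_ex)
  have less: "d \<alpha> = 0" if "total_deg \<alpha> < m" for \<alpha>
    using not_less_Least[of "total_deg \<alpha>" "\<lambda>m. \<exists>\<alpha>. total_deg \<alpha> = m \<and> d \<alpha> \<noteq> 0"] that
    unfolding m_def[symmetric] by blast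
  have d: "\<forall>\<^sub>F z in nhds 0. ((\<lambda>\<alpha>. d \<alpha> * monomial \<alpha> z) has_sum 0) UNIV"
    using a b
  proof eventually_elim
    case (elim z)
    show ?case using has_sum_add[OF elim(1) has_sum_cmult_right[OF elim(2), of "- 1"]]
      by (simp add: d_def algebra_simps)
  qed
  have "hom_sum d m w = 0" for w
  proof -
    have "((\<lambda>c. 0 / c ^ m) \<longlongrightarrow> hom_sum d m w) (at 0)"
      by (rule taylor_limit[OF d less tendsto_const])
    then show ?thesis by (simp add: tendsto_const_iff)
  qed
  then have "d \<alpha> = 0" if "total_deg \<alpha> = m" for \<alpha>
    using monomials_independent[OF finite_total_deg[of m], of d] that by (auto simp: hom_sum_def)
  with ex show False by blast
qed

text \<open>There are two functions because \<open>local_expr\<close> is known to agree with a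
  holomorphic function only near the origin.\<close>

lemma hom_part_dichotomy:
  fixes g :: "complex^'n::finite \<Rightarrow> complex"
  assumes "holo_on S f" and "open S" "0 \<in> S" and fg: "\<forall>z\<in>S. g z = f z"
  obtains (zero) "\<And>w. hom_part g w = 0" "\<forall>\<^sub>F z in nhds 0. g z = 0"
  | (nonzero) "\<exists>w. hom_part g w \<noteq> 0"
      "\<And>\<eta> w. (\<eta> \<longlongrightarrow> w) (at 0) \<Longrightarrow> ((\<lambda>c. g (c *s \<eta> c) / c ^ vanishing_order g) \<longlongrightarrow> hom_part g w) (at 0)"
proof -
  obtain a where "\<forall>\<^sub>F z in nhds 0. ((\<lambda>\<alpha>. a \<alpha> * monomial \<alpha> z) has_sum f z) UNIV"
    using holo_on_has_taylor[OF assms(1-3)] by blast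
  moreover have "\<forall>\<^sub>F z in nhds 0. g z = f z"
    using eventually_nhds_in_open[OF assms(2,3)] by eventually_elim (rule bspec[OF fg])
  ultimately have a: "\<forall>\<^sub>F z in nhds 0. ((\<lambda>\<alpha>. a \<alpha> * monomial \<alpha> z) has_sum g z) UNIV"
    by eventually_elim simp
  have tc: "taylor_coeffs g = a" unfolding taylor_coeffs_def
    by (rule the_equality) (use a taylor_unique in auto)
  let ?m = "vanishing_order g"
  show thesis
  proof (cases "\<exists>\<alpha>. a \<alpha> \<noteq> 0")
    case False
    \<comment> \<open>With all coefficients 0 the sum is 0, whatever value \<open>LEAST\<close>
      takes in \<open>vanishing_order\<close>.\<close>
    then have "hom_part g w = 0" for w by (simp add: hom_part_def tc)
    moreover have "\<forall>\<^sub>F z in nhds 0. g z = 0"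
      using a
    proof eventually_elim
      case (elim z)
      have "((\<lambda>\<alpha>. a \<alpha> * monomial \<alpha> z) has_sum 0) UNIV" using False by (intro has_sum_0) auto
      with elim show ?case by (rule has_sum_unique)
    qed
    ultimately show thesis by (rule zero)
  next
    case True
    then have "\<exists>m \<alpha>. total_deg \<alpha> = m \<and> a \<alpha> \<noteq> 0" by auto
    then have ex: "\<exists>\<alpha>. total_deg \<alpha> = ?m \<and> a \<alpha> \<noteq> 0"
      unfolding vanishing_order_def tc by (rule LeastI_ex)
    have less: "a \<alpha> = 0" if "total_deg \<alpha> < ?m" for \<alpha>
      using not_less_Least[of "total_deg \<alpha>" "\<lambda>m. \<exists>\<alpha>. total_deg \<alpha> = m \<and> a \<alpha> \<noteq> 0"] that
      unfolding vanishing_order_def tc by blast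
    show thesis
    proof (rule nonzero)
      show "\<exists>w. hom_part g w \<noteq> 0"
      proof (rule ccontr)
        assume "\<not> ?thesis"
        then have "a \<alpha> = 0" if "total_deg \<alpha> = ?m" for \<alpha>
          using monomials_independent[OF finite_total_deg[of ?m], of a] that
          by (auto simp: hom_part_def tc)
        with ex show False by blast
      qed
      show "((\<lambda>c. g (c *s \<eta> c) / c ^ ?m) \<longlongrightarrow> hom_part g w) (at 0)" if "(\<eta> \<longlongrightarrow> w) (at 0)" for \<eta> w
        unfolding hom_part_eq tc by (rule taylor_limit[OF a less that])
    qed
  qed
qed

section \<open>Characters and charts\<close>

lemma rvec_mult: "rvec (A *v m) = map_matrix real_of_int A *v rvec m"
  by (simp add: rvec_def vec_eq_iff matrix_vector_mult_def map_matrix_def)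

lemma rvec_diff: "rvec (a - b) = rvec a - rvec b"
  by (simp add: rvec_def vec_eq_iff)

lemma rvec_nth [simp]: "rvec m $ l = real_of_int (m $ l)"
  by (simp add: rvec_def)

lemma inj_rvec: "inj rvec"
  by (auto simp: inj_def vec_eq_iff)

text \<open>Since \<open>0 powi n = 0\<close> for negative \<open>n\<close>, additivity can fail at
  a zero coordinate, for instance for the exponents 1 and -1.\<close>

lemma lmonomial_add:
  assumes "\<And>l. z $ l = 0 \<Longrightarrow> 0 \<le> a $ l \<and> 0 \<le> b $ l"
  shows "lmonomial (a + b) z = lmonomial a z * lmonomial b z"
proof -
  have "z $ l powi (a $ l + b $ l) = z $ l powi (a $ l) * z $ l powi (b $ l)" for l
    using assms[of l] by (cases "z $ l = 0") (auto simp: power_int_add power_int_0_left_if)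
  then show ?thesis by (simp add: lmonomial_def prod.distrib)
qed

lemma lmonomial_nonneg:
  assumes "\<And>l. 0 \<le> a $ l"
  shows "lmonomial a = monomial (\<chi> l. nat (a $ l))"
  using assms by (simp add: lmonomial_def monomial_def fun_eq_iff power_int_def)

lemma lmonomial_0 [simp]: "lmonomial 0 z = 1"
  by (simp add: lmonomial_def)

lemma lmonomial_nonzero: "z \<in> torus \<Longrightarrow> lmonomial a z \<noteq> 0"
  by (simp add: lmonomial_def torus_def)

text \<open>In logarithmic coordinates characters become linear functionals of the exponent, so
  maximizing their modulus is linear programming over the polytope.\<close>

lemma norm_lmonomial_torus:
  assumes "z \<in> torus"
  shows "cmod (lmonomial a z) = exp ((\<chi> l. ln (cmod (z $ l))) \<bullet> rvec a)"
proof -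
  have "cmod (z $ l powi (a $ l)) = exp (ln (cmod (z $ l)) * real_of_int (a $ l))" for l
  proof -
    have "cmod (z $ l) > 0" using assms by (auto simp: torus_def)
    then show ?thesis
      by (simp add: norm_power_int powr_real_of_int'[symmetric] powr_def mult.commute)
  qed
  then show ?thesis
    by (simp add: lmonomial_def prod_norm[symmetric] exp_sum inner_vec_def)
qed

text \<open>The columns of \<open>M\<close> define a homomorphism of tori; pulling a character back
  along it applies \<open>M\<close> to the exponent.\<close>

lemma lmonomial_subst:
  fixes M :: "int^'a::finite^'b::finite"
  assumes z: "z \<in> torus"
  shows "lmonomial (M *v x) z = lmonomial x (\<chi> l. lmonomial (M *v axis l 1) z)"
proof -
  have s: "c powi (\<Sum>l\<in>F. f l) = (\<Prod>l\<in>F. c powi (f l))" if "finite F" "c \<noteq> 0" for c :: complex and f :: "'a \<Rightarrow> int" and F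
    using that(1) by (induction F) (use that(2) in \<open>auto simp: power_int_add\<close>)
  have p: "(\<Prod>i\<in>F. f i) powi k = (\<Prod>i\<in>F. f i powi k)" if "finite F" for f :: "'b \<Rightarrow> complex" and k F
    using that by (induction F) (auto simp: power_int_mult_distrib)
  have "lmonomial (M *v x) z = (\<Prod>i\<in>UNIV. \<Prod>l\<in>UNIV. z $ i powi (M $ i $ l * x $ l))"
    using z by (simp add: lmonomial_def matrix_vector_mult_def s torus_def)
  also have "\<dots> = (\<Prod>l\<in>UNIV. \<Prod>i\<in>UNIV. (z $ i powi (M $ i $ l)) powi (x $ l))"
    unfolding power_int_mult by (rule prod.swap)
  also have "\<dots> = lmonomial x (\<chi> l. lmonomial (M *v axis l 1) z)"
  proof -
    have "(M *v axis l 1) $ i = M $ i $ l" for i l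
      by (simp add: matrix_vector_mult_def axis_def if_distrib cong: if_cong)
    then show ?thesis by (simp add: lmonomial_def p)
  qed
  finally show ?thesis .
qed

section \<open>Density of the torus\<close>

lemma closure_torus: "closure torus = (UNIV :: (complex^'n::finite) set)"
proof -
  have "z \<in> closure torus" for z :: "complex^'n"
    unfolding closure_sequential
  proof (intro exI conjI allI)
    define x :: "nat \<Rightarrow> complex^'n" where
      "x n = (\<chi> l. if z $ l = 0 then of_real (1 / real (Suc n)) else z $ l)" for n
    show "x n \<in> torus" for n
      by (auto simp: x_def torus_def simp del: of_nat_Suc)
    show "x \<longlonglongrightarrow> z"
    proof (rule vec_tendstoI)
      fix l
      have "(\<lambda>n. complex_of_real (1 / real (Suc n))) \<longlonglongrightarrow> of_real 0"
        by (intro tendsto_of_real LIMSEQ_Suc lim_1_over_n)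
      then show "(\<lambda>n. x n $ l) \<longlonglongrightarrow> z $ l" by (cases "z $ l = 0") (simp_all add: x_def)
    qed
  qed
  then show ?thesis by auto
qed

lemma torus_dense_induct:
  fixes z :: "complex^'n::finite"
  assumes "closed {z. P z}" and "\<And>z. z \<in> torus \<Longrightarrow> P z"
  shows "P z"
proof -
  have "closure torus \<subseteq> {z. P z}" using assms by (intro closure_minimal) auto
  then show ?thesis using closure_torus by auto
qed

section \<open>Charts of the toric manifold\<close>

lemma toric_param_Some:
  "(\<And>l. z $ l = 0 \<Longrightarrow> 0 \<le> (A *v m) $ l) \<Longrightarrow> toric_param A z m = Some (lmonomial (A *v m) z)"
  by (simp add: toric_param_def)

lemma lmonomial_axis [simp]: "lmonomial (axis l 1) z = z $ l"
proof -
  have "lmonomial (axis l 1) z = (\<Prod>i\<in>UNIV. if i = l then z $ l else 1)"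
    unfolding lmonomial_def axis_def by (rule prod.cong) auto
  then show ?thesis by simp
qed

lemma inj_toric_param:
  assumes "invertible A"
  shows "inj (toric_param A)"
proof (rule injI)
  fix z y assume eq: "toric_param A z = toric_param A y"
  obtain B where "A ** B = mat 1" using assms by (auto simp: invertible_def)
  then have B: "A *v (B *v axis l 1) = axis l 1" for l by (simp add: matrix_vector_mul_assoc)
  \<comment> \<open>The \<open>l\<close>-th coordinate is itself a character, with exponent
    \<open>B *v axis l 1\<close>, and it is regular on the whole chart.\<close>
  have "toric_param A x (B *v axis l 1) = Some (x $ l)" for x l
  proof -
    have "0 \<le> axis l (1::int) $ i" for i by (simp add: axis_def)
    then show ?thesis using toric_param_Some[of x A "B *v axis l 1"] by (simp add: B)
  qed
  then show "z = y" using eq by (metis option.inject vec_eq_iff)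
qed

text \<open>The coordinates of the chart of \<open>B\<close> are the characters with exponents
  \<open>B' *v axis l 1\<close>; written in the chart of \<open>A\<close> they are the Laurent
  monomials used here.\<close>

lemma toric_param_change:
  assumes z: "z \<in> torus" and "B ** B' = mat 1" "B' ** B = mat 1"
  shows "toric_param B (\<chi> l. lmonomial (A *v (B' *v axis l 1)) z) = toric_param A z"
proof
  fix m
  let ?y = "\<chi> l. lmonomial (A *v (B' *v axis l 1)) z"
  have y: "?y \<in> torus" using lmonomial_nonzero[OF z] by (simp add: torus_def)
  have "A *v m = (A ** B') *v (B *v m)"
    by (metis assms(3) matrix_mul_assoc matrix_mul_rid matrix_vector_mul_assoc)
  then have "lmonomial (A *v m) z = lmonomial (B *v m) ?y"
    using lmonomial_subst[OF z, of "A ** B'" "B *v m"] by (simp add: matrix_vector_mul_assoc)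
  then show "toric_param B ?y m = toric_param A z m"
    using y z by (simp add: toric_param_def torus_def)
qed

section \<open>Delzant polytopes\<close>

definition lattice_vertices :: "(real^'n) set \<Rightarrow> (int^'n) set" where
  "lattice_vertices \<Delta> = {w. rvec w extreme_point_of \<Delta>}"

text \<open>Extreme points of a convex hull belong to the generating set, so the vertices are
  finitely many lattice points. That they span the polytope is the theorem of Minkowski.\<close>

lemma delzant_polytope:
  assumes "delzant (\<Delta> :: (real^'n::finite) set)"
  shows "compact \<Delta>" and "convex \<Delta>" and "finite (lattice_vertices \<Delta>)"
    and "\<Delta> = convex hull (rvec ` lattice_vertices \<Delta>)"
proof -
  obtain S where S: "finite S" "\<Delta> = convex hull (rvec ` S)" using assms by (auto simp: delzant_def)
  show c: "compact \<Delta>" "convex \<Delta>"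
    using S by (auto simp: finite_imp_compact_convex_hull)
  have e: "x \<in> rvec ` S" if "x extreme_point_of \<Delta>" for x
    using that extreme_point_of_convex_hull unfolding S(2) by blast
  then have "rvec ` lattice_vertices \<Delta> \<subseteq> rvec ` S" by (auto simp: lattice_vertices_def)
  then show "finite (lattice_vertices \<Delta>)"
    using S(1) finite_surj inj_rvec by (metis finite_imageD finite_imageI inj_on_subset subset_UNIV)
  have "{x. x extreme_point_of \<Delta>} = rvec ` lattice_vertices \<Delta>"
    using e by (auto simp: lattice_vertices_def)
  then show "\<Delta> = convex hull (rvec ` lattice_vertices \<Delta>)"
    using Krein_Milman_Minkowski[OF c] by simp
qed

lemma vertex_maximizes:
  assumes \<Delta>: "\<Delta> = convex hull (rvec ` V)" and "\<And>w. w \<in> V \<Longrightarrow> a \<bullet> rvec w \<le> c" and "x \<in> \<Delta>"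
  shows "a \<bullet> x \<le> c"
proof -
  have "\<Delta> \<subseteq> {x. a \<bullet> x \<le> c}"
    unfolding \<Delta> using assms(2) by (intro hull_minimal convex_halfspace_le) auto
  then show ?thesis using assms(3) by auto
qed

text \<open>Convexity globalizes the local condition: shrinking \<open>y\<close> towards the vertex
  stays in the polytope and reaches the ball, and the orthant is a cone.\<close>

lemma straightens_orthant:
  assumes s: "straightens \<Delta> v A" and "convex \<Delta>" and "v \<in> \<Delta>"
  shows "moved v A \<Delta> \<subseteq> orthant"
proof
  fix y assume "y \<in> moved v A \<Delta>"
  then obtain x where x: "x \<in> \<Delta>" "y = map_matrix real_of_int A *v (x - v)" by (auto simp: moved_def)
  obtain e where e: "0 < e" "moved v A \<Delta> \<inter> ball 0 e = orthant \<inter> ball 0 e"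
    using s by (auto simp: straightens_def)
  \<comment> \<open>The second entry forces \<open>t * norm y < e\<close>, and the first keeps the
    point on the segment from \<open>v\<close> to \<open>x\<close>.\<close>
  define t where "t = min 1 (e / (2 * (norm y + 1)))"
  have t: "0 < t" "t \<le> 1" using e by (auto simp: t_def add_nonneg_pos intro!: divide_pos_pos)
  have "t * norm y \<le> e / (2 * (norm y + 1)) * norm y"
    by (intro mult_right_mono) (auto simp: t_def)
  also have "\<dots> < e"
  proof -
    have "norm y < 2 * (norm y + 1)" by (smt (verit) norm_ge_zero)
    then have "e * norm y < e * (2 * (norm y + 1))" using e by simp
    moreover have "0 < 2 * (norm y + 1)" by (smt (verit) norm_ge_zero)
    ultimately show ?thesis by (simp only: times_divide_eq_left pos_divide_less_eq)
  qed
  finally have "t *\<^sub>R y \<in> ball 0 e" using t by simp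
  moreover have "t *\<^sub>R y \<in> moved v A \<Delta>"
  proof -
    have "v + t *\<^sub>R (x - v) = (1 - t) *\<^sub>R v + t *\<^sub>R x" by (simp add: algebra_simps)
    then have "v + t *\<^sub>R (x - v) \<in> \<Delta>" using assms(2,3) x(1) t by (auto simp: convex_alt)
    moreover have "t *\<^sub>R y = map_matrix real_of_int A *v (v + t *\<^sub>R (x - v) - v)"
      by (simp add: x(2) matrix_vector_mult_scaleR)
    ultimately show ?thesis unfolding moved_def by blast
  qed
  ultimately have "t *\<^sub>R y \<in> orthant" using e(2) by blast
  then show "y \<in> orthant" using t(1) by (auto simp: orthant_def zero_le_mult_iff)
qed

text \<open>Hence lattice points of the polytope give honest monomials in every chart, also where
  coordinates vanish.\<close>

lemma frame_exponent_nonneg: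
  assumes "convex \<Delta>" and "(v, A) \<in> vertex_frames \<Delta>" and "rvec m \<in> \<Delta>"
  shows "0 \<le> (A *v (m - v)) $ l"
proof -
  have "rvec v \<in> \<Delta>" using assms(2) by (auto simp: vertex_frames_def extreme_point_of_def)
  then have "moved (rvec v) A \<Delta> \<subseteq> orthant"
    using assms by (intro straightens_orthant) (auto simp: vertex_frames_def)
  moreover have "rvec (A *v (m - v)) \<in> moved (rvec v) A \<Delta>"
    using assms(3) by (auto simp: moved_def rvec_mult rvec_diff)
  ultimately have "rvec (A *v (m - v)) \<in> orthant" by blast
  then have "0 \<le> rvec (A *v (m - v)) $ l" unfolding orthant_def by blast
  then show ?thesis by simp
qed

text \<open>The columns of the inverse matrix are the edge directions at the vertex: pull a small
  multiple of a unit vector of the orthant back to the polytope.\<close>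

lemma straightens_edge:
  fixes \<Delta> :: "(real^'n::finite) set"
  assumes s: "straightens \<Delta> v A" and B: "B ** A = mat 1"
  obtains t where "0 < t" "v + t *\<^sub>R rvec (B *v axis l 1) \<in> \<Delta>"
proof -
  obtain e where e: "0 < e" "moved v A \<Delta> \<inter> ball 0 e = orthant \<inter> ball 0 e"
    using s by (auto simp: straightens_def)
  have "(e / 2) *\<^sub>R rvec (axis l 1) \<in> orthant \<inter> ball 0 e"
  proof -
    have r: "rvec (axis l 1) = axis l 1" by (simp add: vec_eq_iff axis_def)
    have "(e / 2) *\<^sub>R axis l 1 \<in> orthant" using e by (simp add: orthant_def axis_def)
    moreover have "(e / 2) *\<^sub>R axis l 1 \<in> ball (0 :: real^'n) e" using e by simp
    ultimately show ?thesis by (simp add: r)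
  qed
  then obtain x where x: "x \<in> \<Delta>" "map_matrix real_of_int A *v (x - v) = (e / 2) *\<^sub>R rvec (axis l 1)"
    using e(2) unfolding moved_def by (metis (no_types, lifting) IntD1 imageE)
  have BA: "map_matrix real_of_int B ** map_matrix real_of_int A = mat 1"
  proof -
    have "map_matrix real_of_int B ** map_matrix real_of_int A = map_matrix real_of_int (B ** A)"
      by (simp add: map_matrix_def matrix_matrix_mult_def vec_eq_iff)
    also have "\<dots> = mat 1" unfolding B by (simp add: map_matrix_def mat_def vec_eq_iff)
    finally show ?thesis .
  qed
  have "x - v = map_matrix real_of_int B *v (map_matrix real_of_int A *v (x - v))"
    by (simp add: matrix_vector_mul_assoc BA)
  also have "\<dots> = (e / 2) *\<^sub>R rvec (B *v axis l 1)"
    by (simp add: x(2) matrix_vector_mult_scaleR rvec_mult)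
  finally have "v + (e / 2) *\<^sub>R rvec (B *v axis l 1) = x" by (metis add.commute diff_add_cancel)
  with x(1) e(1) show thesis by (intro that[of "e / 2"]) auto
qed

section \<open>Metrics on the toric bundle\<close>

lemma toric_bundle_sel [simp]:
  "idx (toric_bundle \<Delta>) = vertex_frames \<Delta>"
  "cdom (toric_bundle \<Delta>) i = UNIV"
  "par (toric_bundle \<Delta>) (u, B) = toric_param B"
  "trf (toric_bundle \<Delta>) (u, B) (w, D) x = the (x (w - u))"
  "patch (toric_bundle \<Delta>) (u, B) = range (toric_param B)"
  by (auto simp: toric_bundle_def patch_def)

lemma vertex_frames_vertex: "(u, B) \<in> vertex_frames \<Delta> \<Longrightarrow> u \<in> lattice_vertices \<Delta>"
  by (simp add: vertex_frames_def lattice_vertices_def)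

lemma lattice_vertices_subset: "w \<in> lattice_vertices \<Delta> \<Longrightarrow> rvec w \<in> \<Delta>"
  by (simp add: lattice_vertices_def extreme_point_of_def)

lemma frame_vertex_nonneg:
  assumes "delzant \<Delta>" and "(u, B) \<in> vertex_frames \<Delta>" and "w \<in> lattice_vertices \<Delta>"
  shows "0 \<le> (B *v (w - u)) $ l"
  using assms delzant_polytope(2) lattice_vertices_subset frame_exponent_nonneg by blast

lemma norm_lmonomial_frame:
  assumes "z \<in> torus"
  shows "cmod (lmonomial (B *v x) z) =
    exp (((\<chi> l. ln (cmod (z $ l))) v* map_matrix real_of_int B) \<bullet> rvec x)"
  by (simp add: norm_lmonomial_torus[OF assms] rvec_mult dot_lmul_matrix)

lemma finite_has_maximal:
  fixes f :: "'a \<Rightarrow> real"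
  assumes "finite V" "V \<noteq> {}"
  obtains w where "w \<in> V" "\<And>w'. w' \<in> V \<Longrightarrow> f w' \<le> f w"
proof -
  have "Max (f ` V) \<in> f ` V" using assms by (intro Max_in) auto
  then obtain w where "w \<in> V" "f w = Max (f ` V)" by auto
  moreover have "f w' \<le> Max (f ` V)" if "w' \<in> V" for w' using that assms by auto
  ultimately show thesis by (metis that)
qed

lemma compact_closed_polydisc: "compact {z::complex^'n::finite. \<forall>l. cmod (z $ l) \<le> 1}"
proof -
  have "norm z \<le> (\<Sum>l\<in>(UNIV::'n set). 1)" if "\<forall>l. cmod (z $ l) \<le> 1" for z :: "complex^'n"
    unfolding norm_vec_def by (intro order_trans[OF L2_set_le_sum] sum_mono) (use that in auto)
  then have "bounded {z::complex^'n. \<forall>l. cmod (z $ l) \<le> 1}" by (auto simp: bounded_iff)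
  moreover have "closed {z::complex^'n. \<forall>l. cmod (z $ l) \<le> 1}"
    by (intro closed_Collect_all closed_Collect_le continuous_intros)
  ultimately show ?thesis by (simp add: compact_eq_bounded_closed)
qed

lemma smooth_metric_continuous:
  assumes "smooth_metric (toric_bundle \<Delta>) \<phi>" and "(u, B) \<in> vertex_frames \<Delta>"
  shows "continuous_on UNIV (\<lambda>z. \<phi> (u, B) (toric_param B z))"
proof -
  have "smooth_on UNIV (\<phi> (u, B) \<circ> toric_param B)"
    using assms by (auto simp: smooth_metric_def)
  then have "Ck_on 0 (\<phi> (u, B) \<circ> toric_param B) UNIV" unfolding smooth_on_def by blast
  then show ?thesis by (simp add: o_def)
qed

text \<open>Every point of the torus lies in the closed unit polydisc of the chart at a vertex
  maximizing the modulus of the corresponding character, so compactness of these finitely many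
  polydiscs bounds the metric.\<close>
lemma metric_near_vertex:
  fixes \<Delta> :: "(real^'n::finite) set"
  assumes \<Delta>: "delzant \<Delta>" and \<phi>: "smooth_metric (toric_bundle \<Delta>) \<phi>"
  obtains C where "\<And>u B z. (u, B) \<in> vertex_frames \<Delta> \<Longrightarrow> z \<in> torus \<Longrightarrow>
    \<exists>w\<in>lattice_vertices \<Delta>.
      (\<forall>w'\<in>lattice_vertices \<Delta>. cmod (lmonomial (B *v (w' - u)) z) \<le> cmod (lmonomial (B *v (w - u)) z)) \<and>
      \<bar>\<phi> (u, B) (toric_param B z) - ln ((cmod (lmonomial (B *v (w - u)) z))\<^sup>2)\<bar> \<le> C"
proof -
  let ?V = "lattice_vertices \<Delta>"
  let ?K = "{z::complex^'n. \<forall>l. cmod (z $ l) \<le> 1}"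
  have "\<forall>w\<in>?V. \<exists>A. (w, A) \<in> vertex_frames \<Delta>"
    using \<Delta> by (auto simp: delzant_def lattice_vertices_def vertex_frames_def)
  then obtain F where F: "\<And>w. w \<in> ?V \<Longrightarrow> (w, F w) \<in> vertex_frames \<Delta>" by metis
  have "\<forall>w\<in>?V. \<exists>c. \<forall>z\<in>?K. \<bar>\<phi> (w, F w) (toric_param (F w) z)\<bar> \<le> c"
  proof
    fix w assume "w \<in> ?V"
    from smooth_metric_continuous[OF \<phi> F[OF this]]
    have "compact ((\<lambda>z. \<phi> (w, F w) (toric_param (F w) z)) ` ?K)"
      by (intro compact_continuous_image compact_closed_polydisc) (rule continuous_on_subset, auto)
    then show "\<exists>c. \<forall>z\<in>?K. \<bar>\<phi> (w, F w) (toric_param (F w) z)\<bar> \<le> c"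
      by (auto dest!: compact_imp_bounded simp: bounded_iff)
  qed
  then obtain c where c: "\<And>w z. w \<in> ?V \<Longrightarrow> z \<in> ?K \<Longrightarrow> \<bar>\<phi> (w, F w) (toric_param (F w) z)\<bar> \<le> c w"
    by metis
  show thesis
  proof (rule that[of "\<Sum>w\<in>?V. \<bar>c w\<bar>"])
    fix u B and z :: "complex^'n" assume uB: "(u, B) \<in> vertex_frames \<Delta>" and z: "z \<in> torus"
    \<comment> \<open>The functional whose value at \<open>rvec x\<close> is the logarithm of the
      modulus of the character \<open>x\<close> at \<open>z\<close>.\<close>
    define a where "a = (\<chi> l. ln (cmod (z $ l))) v* map_matrix real_of_int B"
    have nm: "cmod (lmonomial (B *v x) z) = exp (a \<bullet> rvec x)" for x
      unfolding a_def by (rule norm_lmonomial_frame[OF z])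
    obtain w where w: "w \<in> ?V" "\<And>w'. w' \<in> ?V \<Longrightarrow> a \<bullet> rvec w' \<le> a \<bullet> rvec w"
      using finite_has_maximal[of ?V "\<lambda>w. a \<bullet> rvec w"] delzant_polytope(3)[OF \<Delta>]
        vertex_frames_vertex[OF uB] by blast
    have st: "straightens \<Delta> (rvec w) (F w)" using F[OF w(1)] by (simp add: vertex_frames_def)
    then obtain B' where B': "F w ** B' = mat 1" "B' ** F w = mat 1"
      by (auto simp: straightens_def invertible_def)
    define y where "y = (\<chi> l. lmonomial (B *v (B' *v axis l 1)) z)"
    have py: "toric_param (F w) y = toric_param B z"
      unfolding y_def by (rule toric_param_change[OF z B'])
    \<comment> \<open>The coordinate \<open>y $ l\<close> is the character along an edge leaving
      \<open>w\<close>, and \<open>a\<close> cannot increase along it because \<open>w\<close>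
      maximizes \<open>a\<close> on the polytope.\<close>
    have "cmod (y $ l) \<le> 1" for l
    proof -
      obtain t where t: "0 < t" "rvec w + t *\<^sub>R rvec (B' *v axis l 1) \<in> \<Delta>"
        using straightens_edge[OF st B'(2)] .
      have "a \<bullet> (rvec w + t *\<^sub>R rvec (B' *v axis l 1)) \<le> a \<bullet> rvec w"
        using vertex_maximizes[OF delzant_polytope(4)[OF \<Delta>] w(2) t(2)] .
      then have "a \<bullet> rvec (B' *v axis l 1) \<le> 0"
        using t(1) by (simp add: inner_add_right mult_le_0_iff)
      then show ?thesis by (simp add: y_def nm)
    qed
    then have "\<bar>\<phi> (w, F w) (toric_param B z)\<bar> \<le> c w" using c[OF w(1), of y] by (simp add: py)
    also have "\<dots> \<le> \<bar>c w\<bar>" by simp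
    also have "\<dots> \<le> (\<Sum>w\<in>?V. \<bar>c w\<bar>)"
      using w(1) delzant_polytope(3)[OF \<Delta>] by (intro member_le_sum) auto
    finally have b: "\<bar>\<phi> (w, F w) (toric_param B z)\<bar> \<le> (\<Sum>w\<in>?V. \<bar>c w\<bar>)" .
    \<comment> \<open>The point lies in both charts, whose transition function is the character
      \<open>w - u\<close>; changing charts therefore adds exactly the logarithm to be compared with
      \<phi>.\<close>
    have "toric_param B z \<in> range (toric_param B) \<inter> range (toric_param (F w))"
      using py by (metis IntI rangeI)
    then have "\<phi> (u, B) (toric_param B z) = \<phi> (w, F w) (toric_param B z) +
        ln ((cmod (the (toric_param B z (w - u))))\<^sup>2)"
      using \<phi> uB F[OF w(1)] unfolding smooth_metric_def toric_bundle_sel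
      by (metis toric_bundle_sel(4,5))
    moreover have "toric_param B z (w - u) = Some (lmonomial (B *v (w - u)) z)"
      using z by (intro toric_param_Some) (auto simp: torus_def)
    ultimately have "\<bar>\<phi> (u, B) (toric_param B z) - ln ((cmod (lmonomial (B *v (w - u)) z))\<^sup>2)\<bar> \<le> (\<Sum>w\<in>?V. \<bar>c w\<bar>)"
      using b by simp
    moreover have "cmod (lmonomial (B *v (w' - u)) z) \<le> cmod (lmonomial (B *v (w - u)) z)" if "w' \<in> ?V" for w'
      using w(2)[OF that] by (simp add: nm rvec_diff inner_diff_right)
    ultimately show "\<exists>w\<in>?V. (\<forall>w'\<in>?V. cmod (lmonomial (B *v (w' - u)) z) \<le> cmod (lmonomial (B *v (w - u)) z)) \<and>
      \<bar>\<phi> (u, B) (toric_param B z) - ln ((cmod (lmonomial (B *v (w - u)) z))\<^sup>2)\<bar> \<le> (\<Sum>w\<in>?V. \<bar>c w\<bar>)"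
      using w(1) by blast
  qed
qed

lemma continuous_on_lmonomial [continuous_intros]:
  assumes "\<And>l. 0 \<le> a $ l"
  shows "continuous_on S (lmonomial a)"
  unfolding lmonomial_nonneg[OF assms] monomial_def by (intro continuous_intros)

text \<open>The maximal vertex character dominates the others, and on the torus it has the size of
  the metric; continuity then reaches the whole chart. One constant serves all charts, as membership
  in the unit ball requires.\<close>

lemma vertex_section_bound:
  fixes \<Delta> :: "(real^'n::finite) set"
  assumes \<Delta>: "delzant \<Delta>" and \<phi>: "smooth_metric (toric_bundle \<Delta>) \<phi>"
  obtains C where "\<And>u B w z. (u, B) \<in> vertex_frames \<Delta> \<Longrightarrow> w \<in> lattice_vertices \<Delta> \<Longrightarrow>
    (cmod (lmonomial (B *v (w - u)) z))\<^sup>2 \<le> exp (C + \<phi> (u, B) (toric_param B z))"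
proof -
  obtain C where C: "\<And>u B z. (u, B) \<in> vertex_frames \<Delta> \<Longrightarrow> z \<in> torus \<Longrightarrow>
    \<exists>w\<in>lattice_vertices \<Delta>.
      (\<forall>w'\<in>lattice_vertices \<Delta>. cmod (lmonomial (B *v (w' - u)) z) \<le> cmod (lmonomial (B *v (w - u)) z)) \<and>
      \<bar>\<phi> (u, B) (toric_param B z) - ln ((cmod (lmonomial (B *v (w - u)) z))\<^sup>2)\<bar> \<le> C"
    using metric_near_vertex[OF \<Delta> \<phi>] by blast
  show thesis
  proof (rule that[of C])
    fix u B w and z :: "complex^'n"
    assume uB: "(u, B) \<in> vertex_frames \<Delta>" and w: "w \<in> lattice_vertices \<Delta>"
    show "(cmod (lmonomial (B *v (w - u)) z))\<^sup>2 \<le> exp (C + \<phi> (u, B) (toric_param B z))"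
    proof (rule torus_dense_induct[where z = z])
      show "closed {z. (cmod (lmonomial (B *v (w - u)) z))\<^sup>2 \<le> exp (C + \<phi> (u, B) (toric_param B z))}"
        by (intro closed_Collect_le continuous_intros smooth_metric_continuous[OF \<phi> uB]
            frame_vertex_nonneg[OF \<Delta> uB w])
      fix z :: "complex^'n" assume z: "z \<in> torus"
      obtain w0 where w0: "cmod (lmonomial (B *v (w - u)) z) \<le> cmod (lmonomial (B *v (w0 - u)) z)"
        "\<bar>\<phi> (u, B) (toric_param B z) - ln ((cmod (lmonomial (B *v (w0 - u)) z))\<^sup>2)\<bar> \<le> C"
        using C[OF uB z] w by blast
      have "(cmod (lmonomial (B *v (w - u)) z))\<^sup>2 \<le> (cmod (lmonomial (B *v (w0 - u)) z))\<^sup>2"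
        using w0(1) by (intro power_mono) auto
      also have "\<dots> = exp (ln ((cmod (lmonomial (B *v (w0 - u)) z))\<^sup>2))"
        using lmonomial_nonzero[OF z] by simp
      also have "\<dots> \<le> exp (C + \<phi> (u, B) (toric_param B z))" using w0(2) by simp
      finally show "(cmod (lmonomial (B *v (w - u)) z))\<^sup>2 \<le> exp (C + \<phi> (u, B) (toric_param B z))" .
    qed
  qed
qed

section \<open>The toric growth function\<close>

definition growth_exponents :: "(real^'n) set \<Rightarrow> int^'n \<Rightarrow> int^'n^'n \<Rightarrow> nat \<Rightarrow> (int^'n) set" where
  "growth_exponents \<Delta> v A k = {\<alpha>. rvec \<alpha> \<in> (\<lambda>x. real k *\<^sub>R x) ` moved (rvec v) A \<Delta>}"

lemma finite_growth_exponents: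
  fixes \<Delta> :: "(real^'n::finite) set"
  assumes "compact \<Delta>"
  shows "finite (growth_exponents \<Delta> v A k)"
proof -
  have "continuous_on \<Delta> (\<lambda>x. real k *\<^sub>R (map_matrix real_of_int A *v (x - rvec v)))"
    by (intro continuous_intros matrix_vector_mult_linear_continuous_on[THEN continuous_on_compose2]) auto
  then have "bounded ((\<lambda>x. real k *\<^sub>R (map_matrix real_of_int A *v (x - rvec v))) ` \<Delta>)"
    using assms compact_continuous_image compact_imp_bounded by blast
  then obtain M where M: "\<And>x. x \<in> \<Delta> \<Longrightarrow> norm (real k *\<^sub>R (map_matrix real_of_int A *v (x - rvec v))) \<le> M"
    by (auto simp: bounded_iff)
  have "growth_exponents \<Delta> v A k \<subseteq> {\<alpha>. \<forall>l. \<alpha> $ l \<in> {- \<lceil>M\<rceil>..\<lceil>M\<rceil>}}"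
  proof clarify
    fix \<alpha> l assume "\<alpha> \<in> growth_exponents \<Delta> v A k"
    then have "norm (rvec \<alpha>) \<le> M" using M by (auto simp: growth_exponents_def moved_def)
    then have "\<bar>rvec \<alpha> $ l\<bar> \<le> M" using component_le_norm_cart order_trans by blast
    then have "\<bar>real_of_int (\<alpha> $ l)\<bar> \<le> M" by simp
    then show "\<alpha> $ l \<in> {- \<lceil>M\<rceil>..\<lceil>M\<rceil>}" by (simp, linarith)
  qed
  then show ?thesis by (rule finite_subset) (rule finite_vec_set, simp)
qed

lemma growth_exponents_nonneg:
  assumes "convex \<Delta>" and "(v, A) \<in> vertex_frames \<Delta>" and "\<alpha> \<in> growth_exponents \<Delta> v A k"
  shows "0 \<le> \<alpha> $ l"
proof -
  have "rvec v \<in> \<Delta>" using assms(2) by (auto simp: vertex_frames_def extreme_point_of_def)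
  then have m: "moved (rvec v) A \<Delta> \<subseteq> orthant"
    using assms by (intro straightens_orthant) (auto simp: vertex_frames_def)
  obtain y where "y \<in> moved (rvec v) A \<Delta>" "rvec \<alpha> = real k *\<^sub>R y"
    using assms(3) by (auto simp: growth_exponents_def)
  then have "0 \<le> rvec \<alpha> $ l" using m by (auto simp: orthant_def)
  then show ?thesis by simp
qed

lemma vertex_growth_exponent:
  assumes "w \<in> lattice_vertices \<Delta>"
  shows "(\<chi> l. int k * (A *v (w - v)) $ l) \<in> growth_exponents \<Delta> v A k"
proof -
  have "map_matrix real_of_int A *v (rvec w - rvec v) \<in> moved (rvec v) A \<Delta>"
    using lattice_vertices_subset[OF assms] by (simp add: moved_def)
  moreover have "rvec (\<chi> l. int k * (A *v (w - v)) $ l) = real k *\<^sub>R (map_matrix real_of_int A *v (rvec w - rvec v))"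
    by (simp add: rvec_diff[symmetric] rvec_mult[symmetric] vec_eq_iff)
  ultimately show ?thesis unfolding growth_exponents_def by blast
qed

lemma lmonomial_multiple:
  assumes "\<And>l. 0 \<le> a $ l"
  shows "lmonomial (\<chi> l. int k * a $ l) z = lmonomial a z ^ k"
  using assms by (simp add: lmonomial_def power_int_mult mult.commute[of "int k"] prod_power_distrib)

text \<open>On the torus a linear functional on the dilated polytope is largest at a dilated vertex.
  This vertex depends on \<open>z\<close>, but a finite union of closed sets is closed, so density
  still applies.\<close>

lemma growth_exponent_vertex_bound:
  fixes \<Delta> :: "(real^'n::finite) set"
  assumes \<Delta>: "delzant \<Delta>" and vA: "(v, A) \<in> vertex_frames \<Delta>" and \<alpha>: "\<alpha> \<in> growth_exponents \<Delta> v A k"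
  shows "\<exists>w\<in>lattice_vertices \<Delta>. cmod (lmonomial \<alpha> z) \<le> cmod (lmonomial (A *v (w - v)) z) ^ k"
proof (rule torus_dense_induct[where z = z])
  let ?V = "lattice_vertices \<Delta>"
  have "closed (\<Union>w\<in>?V. {z. cmod (lmonomial \<alpha> z) \<le> cmod (lmonomial (A *v (w - v)) z) ^ k})"
    by (intro closed_UN delzant_polytope(3)[OF \<Delta>] ballI closed_Collect_le continuous_intros
        growth_exponents_nonneg[OF delzant_polytope(2)[OF \<Delta>] vA \<alpha>] frame_vertex_nonneg[OF \<Delta> vA])
  then show "closed {z. \<exists>w\<in>?V. cmod (lmonomial \<alpha> z) \<le> cmod (lmonomial (A *v (w - v)) z) ^ k}"
    by (simp only: Collect_bex_eq)
  fix z :: "complex^'n" assume z: "z \<in> torus"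
  define b where "b = (\<chi> l. ln (cmod (z $ l)))"
  define a where "a = b v* map_matrix real_of_int A"
  have nm: "cmod (lmonomial (A *v x) z) = exp (a \<bullet> rvec x)" for x
    unfolding a_def b_def by (rule norm_lmonomial_frame[OF z])
  obtain w where w: "w \<in> ?V" "\<And>w'. w' \<in> ?V \<Longrightarrow> a \<bullet> rvec w' \<le> a \<bullet> rvec w"
    using finite_has_maximal[of ?V "\<lambda>w. a \<bullet> rvec w"] delzant_polytope(3)[OF \<Delta>]
      vertex_frames_vertex[OF vA] by blast
  obtain x where x: "x \<in> \<Delta>" "rvec \<alpha> = real k *\<^sub>R (map_matrix real_of_int A *v (x - rvec v))"
    using \<alpha> by (auto simp: growth_exponents_def moved_def)
  have "b \<bullet> rvec \<alpha> = real k * (a \<bullet> (x - rvec v))" by (simp add: x(2) a_def dot_lmul_matrix)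
  also have "\<dots> \<le> real k * (a \<bullet> rvec (w - v))"
    using vertex_maximizes[OF delzant_polytope(4)[OF \<Delta>] w(2) x(1)]
    by (intro mult_left_mono) (auto simp: rvec_diff inner_diff_right)
  finally have "cmod (lmonomial \<alpha> z) \<le> cmod (lmonomial (A *v (w - v)) z) ^ k"
    by (subst nm) (simp add: norm_lmonomial_torus[OF z] b_def exp_of_nat_mult[symmetric])
  with w(1) show "\<exists>w\<in>?V. cmod (lmonomial \<alpha> z) \<le> cmod (lmonomial (A *v (w - v)) z) ^ k" ..
qed

section \<open>The growth sum against the vertex characters\<close>

context
  fixes \<Delta> :: "(real^'n::finite) set" and v A k
  assumes \<Delta>: "delzant \<Delta>" and vA: "(v, A) \<in> vertex_frames \<Delta>" and k: "1 \<le> (k::nat)"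
begin

lemma toric_growth_altdef:
  "toric_growth \<Delta> v A k z = 1 / real k * ln (\<Sum>\<alpha>\<in>growth_exponents \<Delta> v A k. (cmod (lmonomial \<alpha> z))\<^sup>2)"
  by (simp add: toric_growth_def growth_exponents_def)

lemma finite_exponents: "finite (growth_exponents \<Delta> v A k)"
  using delzant_polytope(1)[OF \<Delta>] by (rule finite_growth_exponents)

lemma growth_sum_vertex:
  assumes "w \<in> lattice_vertices \<Delta>"
  shows "((cmod (lmonomial (A *v (w - v)) z))\<^sup>2) ^ k \<le>
    (\<Sum>\<alpha>\<in>growth_exponents \<Delta> v A k. (cmod (lmonomial \<alpha> z))\<^sup>2)"
proof -
  have "((cmod (lmonomial (A *v (w - v)) z))\<^sup>2) ^ k = (cmod (lmonomial (\<chi> l. int k * (A *v (w - v)) $ l) z))\<^sup>2"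
    using lmonomial_multiple[OF frame_vertex_nonneg[OF \<Delta> vA assms]]
    by (simp add: norm_power power_mult[symmetric] mult.commute)
  also have "\<dots> \<le> (\<Sum>\<alpha>\<in>growth_exponents \<Delta> v A k. (cmod (lmonomial \<alpha> z))\<^sup>2)"
    by (rule member_le_sum[OF vertex_growth_exponent[OF assms]]) (auto simp: finite_exponents)
  finally show ?thesis .
qed

text \<open>The vertex \<open>v\<close> contributes the exponent 0 and hence the summand 1, which
  keeps the logarithm away from its singularity.\<close>

lemma growth_sum_ge_1: "1 \<le> (\<Sum>\<alpha>\<in>growth_exponents \<Delta> v A k. (cmod (lmonomial \<alpha> z))\<^sup>2)"
  using growth_sum_vertex[OF vertex_frames_vertex[OF vA], of z] by simp

lemma exp_toric_growth:
  "exp (toric_growth \<Delta> v A k z) ^ k = (\<Sum>\<alpha>\<in>growth_exponents \<Delta> v A k. (cmod (lmonomial \<alpha> z))\<^sup>2)"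
  using growth_sum_ge_1[of z] k unfolding toric_growth_altdef
  by (simp add: exp_of_nat_mult[symmetric])

lemma toric_growth_ge_vertex:
  assumes "w \<in> lattice_vertices \<Delta>"
  shows "(cmod (lmonomial (A *v (w - v)) z))\<^sup>2 \<le> exp (toric_growth \<Delta> v A k z)"
  using growth_sum_vertex[OF assms, of z] k unfolding exp_toric_growth[symmetric]
  by (subst (asm) power_mono_iff) auto

lemma continuous_on_toric_growth: "continuous_on S (toric_growth \<Delta> v A k)"
  unfolding toric_growth_altdef[abs_def]
  using growth_sum_ge_1
  by (intro continuous_intros growth_exponents_nonneg[OF delzant_polytope(2)[OF \<Delta>] vA])
    (auto simp: not_le[symmetric] dest: spec intro: order_trans, smt (verit))

text \<open>Lets a bound on the circle orbit of a point be expressed by the growth at that point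
  alone.\<close>

lemma toric_growth_rotate:
  assumes "cmod c = 1"
  shows "toric_growth \<Delta> v A k (c *s z) = toric_growth \<Delta> v A k z"
proof -
  have "cmod (lmonomial \<alpha> (c *s z)) = cmod (lmonomial \<alpha> z)" for \<alpha>
    by (simp add: lmonomial_def prod_norm[symmetric] norm_power_int norm_mult assms)
  then show ?thesis by (simp add: toric_growth_altdef)
qed

lemma toric_growth_le_vertex:
  "\<exists>w\<in>lattice_vertices \<Delta>. lmonomial (A *v (w - v)) z \<noteq> 0 \<and>
     toric_growth \<Delta> v A k z \<le> ln (real (card (growth_exponents \<Delta> v A k))) +
       ln ((cmod (lmonomial (A *v (w - v)) z))\<^sup>2)"
proof -
  let ?V = "lattice_vertices \<Delta>" and ?E = "growth_exponents \<Delta> v A k"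
  let ?f = "\<lambda>w. cmod (lmonomial (A *v (w - v)) z)"
  obtain w where w: "w \<in> ?V" "\<And>w'. w' \<in> ?V \<Longrightarrow> ?f w' \<le> ?f w"
    using finite_has_maximal[of ?V ?f] delzant_polytope(3)[OF \<Delta>] vertex_frames_vertex[OF vA] by blast
  have "1 \<le> ?f w" using w(2)[OF vertex_frames_vertex[OF vA]] by simp
  have N: "1 \<le> real (card ?E)"
    using vertex_growth_exponent[OF w(1)] finite_exponents by (metis card_gt_0_iff empty_iff less_eq_real_def of_nat_1 of_nat_le_iff less_one not_le)
  have "(cmod (lmonomial \<alpha> z))\<^sup>2 \<le> ((?f w)\<^sup>2) ^ k" if "\<alpha> \<in> ?E" for \<alpha>
  proof -
    obtain w' where "w' \<in> ?V" "cmod (lmonomial \<alpha> z) \<le> ?f w' ^ k"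
      using growth_exponent_vertex_bound[OF \<Delta> vA \<open>\<alpha> \<in> ?E\<close>] by blast
    then have "cmod (lmonomial \<alpha> z) \<le> ?f w ^ k"
      using power_mono[OF w(2), of w' k] by force
    then have "(cmod (lmonomial \<alpha> z))\<^sup>2 \<le> (?f w ^ k)\<^sup>2" by (intro power_mono) auto
    then show ?thesis by (simp add: power_mult[symmetric] mult.commute)
  qed
  then have "exp (toric_growth \<Delta> v A k z) ^ k \<le> real (card ?E) * ((?f w)\<^sup>2) ^ k"
    unfolding exp_toric_growth by (intro sum_bounded_above) auto
  \<comment> \<open>A crude enlargement that allows taking \<open>k\<close>-th roots; it is why the
    constant is the logarithm of the cardinality, undivided by \<open>k\<close>.\<close>
  also have "\<dots> \<le> real (card ?E) ^ k * ((?f w)\<^sup>2) ^ k"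
    using N k by (intro mult_right_mono self_le_power) auto
  also have "\<dots> = (real (card ?E) * (?f w)\<^sup>2) ^ k" by (simp add: power_mult_distrib)
  finally have "exp (toric_growth \<Delta> v A k z) \<le> real (card ?E) * (?f w)\<^sup>2"
    using k by (subst (asm) power_mono_iff) auto
  then have "toric_growth \<Delta> v A k z \<le> ln (real (card ?E) * (?f w)\<^sup>2)"
    using N \<open>1 \<le> ?f w\<close> by (subst ln_ge_iff) (auto intro!: mult_pos_pos)
  also have "\<dots> = ln (real (card ?E)) + ln ((?f w)\<^sup>2)"
    using N \<open>1 \<le> ?f w\<close> by (intro ln_mult_pos) auto
  finally show ?thesis using w(1) \<open>1 \<le> ?f w\<close> by (intro bexI[of _ w]) auto
qed

text \<open>On the torus the metric is close to one vertex term, and each vertex term is below the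
  growth function; both sides are continuous on the chart.\<close>

lemma metric_le_toric_growth:
  assumes \<phi>: "smooth_metric (toric_bundle \<Delta>) \<phi>"
  obtains C where "\<And>z. \<phi> (v, A) (toric_param A z) \<le> C + toric_growth \<Delta> v A k z"
proof -
  obtain C where C: "\<And>u B z. (u, B) \<in> vertex_frames \<Delta> \<Longrightarrow> z \<in> torus \<Longrightarrow>
    \<exists>w\<in>lattice_vertices \<Delta>.
      (\<forall>w'\<in>lattice_vertices \<Delta>. cmod (lmonomial (B *v (w' - u)) z) \<le> cmod (lmonomial (B *v (w - u)) z)) \<and>
      \<bar>\<phi> (u, B) (toric_param B z) - ln ((cmod (lmonomial (B *v (w - u)) z))\<^sup>2)\<bar> \<le> C"
    using metric_near_vertex[OF \<Delta> \<phi>] by blast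
  have "\<phi> (v, A) (toric_param A z) \<le> C + toric_growth \<Delta> v A k z" for z
  proof (rule torus_dense_induct[where z = z])
    show "closed {z. \<phi> (v, A) (toric_param A z) \<le> C + toric_growth \<Delta> v A k z}"
      by (intro closed_Collect_le continuous_intros continuous_on_toric_growth smooth_metric_continuous[OF \<phi> vA])
    fix z :: "complex^'n" assume z: "z \<in> torus"
    obtain w where w: "w \<in> lattice_vertices \<Delta>"
      "\<bar>\<phi> (v, A) (toric_param A z) - ln ((cmod (lmonomial (A *v (w - v)) z))\<^sup>2)\<bar> \<le> C"
      using C[OF vA z] by blast
    have "ln ((cmod (lmonomial (A *v (w - v)) z))\<^sup>2) \<le> toric_growth \<Delta> v A k z"
      using toric_growth_ge_vertex[OF w(1), of z] lmonomial_nonzero[OF z]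
        ln_le_cancel_iff[of "(cmod (lmonomial (A *v (w - v)) z))\<^sup>2" "exp (toric_growth \<Delta> v A k z)"] by simp
    with w(2) show "\<phi> (v, A) (toric_param A z) \<le> C + toric_growth \<Delta> v A k z" by linarith
  qed
  then show thesis using that by blast
qed

end

section \<open>Leading parts in local frames\<close>

lemma holo_on_const [intro]: "holo_on S (\<lambda>_. c)"
  by (auto simp: holo_on_def intro!: exI[of _ "\<lambda>_. 0"])

lemma holo_on_nth [intro]: "holo_on S (\<lambda>z. z $ l)"
  unfolding holo_on_def
  by (intro ballI exI[of _ "\<lambda>v. v $ l"] conjI bounded_linear_imp_has_derivative bounded_linear_vec_nth) simp

lemma holo_on_mult:
  assumes "holo_on S f" and "holo_on S g"
  shows "holo_on S (\<lambda>z. f z * g z)"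
  unfolding holo_on_def
proof
  fix z assume z: "z \<in> S"
  obtain D E where D: "(f has_derivative D) (at z)" "\<And>c v. D (c *s v) = c * D v"
    and E: "(g has_derivative E) (at z)" "\<And>c v. E (c *s v) = c * E v"
    using assms z unfolding holo_on_def by metis
  show "\<exists>D. ((\<lambda>z. f z * g z) has_derivative D) (at z) \<and> (\<forall>c v. D (c *s v) = c * D v)"
    by (rule exI, rule conjI, rule has_derivative_mult[OF D(1) E(1)]) (simp add: D E algebra_simps)
qed

lemma holo_on_power: "holo_on S f \<Longrightarrow> holo_on S (\<lambda>z. f z ^ k)"
  by (induction k) (auto intro: holo_on_mult)

lemma holo_on_prod: "finite I \<Longrightarrow> (\<And>i. i \<in> I \<Longrightarrow> holo_on S (f i)) \<Longrightarrow> holo_on S (\<lambda>z. \<Prod>i\<in>I. f i z)"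
  by (induction I rule: finite_induct) (auto intro: holo_on_mult)

lemma holo_on_monomial: "holo_on S (monomial \<alpha>)"
  unfolding monomial_def[abs_def] by (intro holo_on_prod holo_on_power holo_on_nth) auto

lemma holo_map_on_derivative:
  fixes F :: "complex^'n::finite \<Rightarrow> complex^'n"
  assumes "holo_map_on S F" and "z \<in> S"
  shows "\<exists>D. (F has_derivative D) (at z) \<and> (\<forall>c v. D (c *s v) = c *s D v)"
proof -
  have "\<forall>l. \<exists>d. ((\<lambda>z. F z $ l) has_derivative d) (at z) \<and> (\<forall>c v. d (c *s v) = c * d v)"
    using assms by (auto simp: holo_map_on_def holo_on_def)
  then obtain d where d: "\<And>l. ((\<lambda>z. F z $ l) has_derivative d l) (at z)" "\<And>l c v. d l (c *s v) = c * d l v"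
    by metis
  have ax: "bounded_linear (\<lambda>c::complex. axis l c :: complex^'n)" for l
    by (intro linear_conv_bounded_linear[THEN iffD1] linearI) (auto simp: vec_eq_iff axis_def)
  have eq: "(\<Sum>l\<in>UNIV. axis l (x $ l)) = x" for x :: "complex^'n"
    by (simp add: vec_eq_iff axis_def if_distrib cong: if_cong)
  have "((\<lambda>z. \<Sum>l\<in>UNIV. axis l (F z $ l)) has_derivative (\<lambda>v. \<Sum>l\<in>UNIV. axis l (d l v))) (at z)"
    by (intro has_derivative_sum bounded_linear.has_derivative[OF ax] d)
  then have F: "(F has_derivative (\<lambda>v. \<Sum>l\<in>UNIV. axis l (d l v))) (at z)" by (simp add: eq)
  show ?thesis
    by (rule exI, rule conjI, rule F) (simp add: vec_eq_iff d axis_def if_distrib sum_distrib_left cong: if_cong)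
qed

lemma holo_on_compose:
  fixes F :: "complex^'n::finite \<Rightarrow> complex^'n"
  assumes F: "holo_map_on S F" and f: "holo_on T f" and "F ` S \<subseteq> T"
  shows "holo_on S (\<lambda>z. f (F z))"
  unfolding holo_on_def
proof
  fix z assume z: "z \<in> S"
  obtain D where D: "(F has_derivative D) (at z)" "\<And>c v. D (c *s v) = c *s D v"
    using holo_map_on_derivative[OF F z] by auto
  obtain E where E: "(f has_derivative E) (at (F z))" "\<And>c v. E (c *s v) = c * E v"
    using f assms(3) z unfolding holo_on_def by blast
  show "\<exists>D. ((\<lambda>z. f (F z)) has_derivative D) (at z) \<and> (\<forall>c v. D (c *s v) = c * D v)"
    by (intro exI conjI, rule has_derivative_compose[OF D(1) E(1)]) (simp add: D E)
qed

section \<open>Restriction to complex lines through the origin\<close>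

lemma has_derivative_line:
  fixes F :: "complex^'n::finite \<Rightarrow> 'b::real_normed_vector"
  assumes "(F has_derivative D) (at (c *s \<xi>))"
  shows "((\<lambda>c. F (c *s \<xi>)) has_derivative (\<lambda>h. D (h *s \<xi>))) (at c)"
proof -
  have "bounded_linear (\<lambda>c::complex. c *s \<xi>)"
    by (intro linear_conv_bounded_linear[THEN iffD1] linearI) (auto simp: vec_eq_iff algebra_simps)
  from has_derivative_compose[OF bounded_linear_imp_has_derivative[OF this] assms] show ?thesis .
qed

lemma holo_on_line:
  fixes f :: "complex^'n::finite \<Rightarrow> complex"
  assumes "holo_on UNIV f"
  shows "(\<lambda>c. f (c *s \<xi>)) holomorphic_on UNIV"
proof (rule holomorphic_onI)
  fix c
  obtain D where D: "(f has_derivative D) (at (c *s \<xi>))" "\<And>c v. D (c *s v) = c * D v"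
    using assms unfolding holo_on_def by blast
  have "((\<lambda>c. f (c *s \<xi>)) has_field_derivative D \<xi>) (at c)"
    using has_derivative_line[OF D(1)] by (simp add: D(2) has_field_derivative_def mult.commute[of _ "D _"])
  then show "(\<lambda>c. f (c *s \<xi>)) field_differentiable at c within UNIV"
    by (auto simp: field_differentiable_def)
qed

text \<open>Supplies the converging directions for \<open>taylor_limit\<close>; complex linearity of
  \<open>D\<close> makes the limit independent of how \<open>c\<close> approaches 0.\<close>

lemma derivative_quotient_tendsto:
  fixes F :: "complex^'n::finite \<Rightarrow> complex^'n"
  assumes F: "(F has_derivative D) (at 0)" and D: "\<And>c v. D (c *s v) = c *s D v" and "F 0 = 0"
  shows "((\<lambda>c. inverse c *s F (c *s \<xi>)) \<longlongrightarrow> D \<xi>) (at 0)"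
proof (rule vec_tendstoI)
  fix l
  have "((\<lambda>c. F (c *s \<xi>)) has_derivative (\<lambda>h. D (h *s \<xi>))) (at 0)"
    using F by (intro has_derivative_line) (simp add: vec_eq_iff[symmetric])
  from bounded_linear.has_derivative[OF bounded_linear_vec_nth this, of l]
  have "((\<lambda>c. F (c *s \<xi>) $ l) has_field_derivative D \<xi> $ l) (at 0)"
    by (simp add: D has_field_derivative_def mult.commute[of _ "D _ $ _"])
  then show "((\<lambda>c. (inverse c *s F (c *s \<xi>)) $ l) \<longlongrightarrow> D \<xi> $ l) (at 0)"
    by (simp add: has_field_derivative_iff \<open>F 0 = 0\<close> divide_inverse mult.commute)
qed

text \<open>\<open>L\<close> fills the removable singularity of \<open>q c / c ^ m\<close>, and
  dividing by \<open>c ^ m\<close> does not change the modulus on the unit circle.\<close>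

lemma leading_coeff_bound:
  assumes q: "q holomorphic_on UNIV" and L: "((\<lambda>c. q c / c ^ m) \<longlongrightarrow> L) (at 0)"
    and B: "\<And>c. cmod c = 1 \<Longrightarrow> cmod (q c) \<le> B"
  shows "cmod L \<le> B"
proof -
  define h where "h c = (if c = 0 then L else q c / c ^ m)" for c
  have "(\<lambda>c. q c / c ^ m) holomorphic_on UNIV - {0}"
    by (intro holomorphic_intros holomorphic_on_subset[OF q]) auto
  then have 1: "h holomorphic_on UNIV - {0}"
    by (rule holomorphic_transform) (simp add: h_def)
  have "(h \<longlongrightarrow> L) (at 0)"
    by (rule Lim_transform_eventually[OF L])
      (use eventually_neq_at_within[of "0::complex"] in \<open>eventually_elim, simp add: h_def\<close>)
  then have h: "h holomorphic_on UNIV"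
    by (intro no_isolated_singularity'[OF _ 1]) (auto simp: h_def[of 0])
  have "cmod (h 0) \<le> B"
  proof (rule maximum_modulus_frontier[of h "ball 0 1"])
    show "h holomorphic_on interior (ball 0 1)" using h holomorphic_on_subset by blast
    show "continuous_on (closure (ball 0 1)) h"
      using h holomorphic_on_imp_continuous_on continuous_on_subset by blast
    fix c :: complex assume "c \<in> frontier (ball 0 1)"
    then have "cmod c = 1" by (simp add: frontier_ball)
    then show "cmod (h c) \<le> B" using B by (auto simp: h_def norm_divide norm_power)
  qed auto
  then show ?thesis by (simp add: h_def)
qed

text \<open>The transition factors of \<open>\<tau>\<close> and \<open>s\<close> cancel, so the
  chart picked by \<open>SOME\<close> can be replaced by any other.\<close>

lemma local_expr_eq:
  assumes fr: "local_frame L p W \<theta> \<tau>" and s: "s \<in> hol_sections L k"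
    and i: "i \<in> idx L" and w: "w \<in> W" "\<theta> w \<in> patch L i"
  shows "local_expr L \<theta> \<tau> k s w = \<tau> i (\<theta> w) ^ k * s i (\<theta> w)"
proof -
  define j where "j = (SOME i. i \<in> idx L \<and> \<theta> w \<in> patch L i)"
  have j: "j \<in> idx L" "\<theta> w \<in> patch L j"
    using someI[of "\<lambda>i. i \<in> idx L \<and> \<theta> w \<in> patch L i" i] i w unfolding j_def by auto
  have "\<tau> i (\<theta> w) = \<tau> j (\<theta> w) * trf L j i (\<theta> w)"
    using fr i j w unfolding local_frame_def by blast
  moreover have "s j (\<theta> w) = trf L j i (\<theta> w) ^ k * s i (\<theta> w)"
    using s i j w unfolding hol_sections_def by blast
  ultimately show ?thesis
    by (simp add: local_expr_def j_def[symmetric] Let_def power_mult_distrib)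
qed

text \<open>Here \<open>E\<close> is the inverse of \<open>D\<close> and \<open>t\<close> is the value at \<open>p\<close> of \<open>\<tau>\<close>; the limit is the leading
  part of the section in the given chart.\<close>
lemma hom_part_local_expr:
  fixes L :: "('i, 'a, 'n::finite) line_bundle"
  assumes fr: "local_frame L p W \<theta> \<tau>" and i: "i \<in> idx L" "cdom L i = UNIV"
    and inj: "inj (par L i)" and p: "par L i 0 = p"
  defines "D \<equiv> frechet_derivative (inv_into W \<theta> \<circ> par L i) (at 0)"
  obtains E t where "bounded_linear E" "\<And>v. E (D v) = v" "\<And>v. D (E v) = v" "t \<noteq> 0"
    "\<And>k s. s \<in> hol_sections L k \<Longrightarrow>
       ((\<forall>w. hom_part (local_expr L \<theta> \<tau> k s) w = 0) \<and> (\<forall>\<^sub>F z in nhds 0. s i (par L i z) = 0)) \<or>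
       ((\<exists>w. hom_part (local_expr L \<theta> \<tau> k s) w \<noteq> 0) \<and>
        (\<exists>m. \<forall>\<xi>. ((\<lambda>c. s i (par L i (c *s \<xi>)) / c ^ m) \<longlongrightarrow>
           hom_part (local_expr L \<theta> \<tau> k s) (D \<xi>) / t ^ k) (at 0)))"
proof -
  let ?P = "par L i"
  \<comment> \<open>\<open>F\<close> and \<open>G\<close> are the two directions of the coordinate
    change between chart and frame, inverse to each other on the overlaps \<open>S\<close> and
    \<open>T\<close>.\<close>
  define F where "F = inv_into W \<theta> \<circ> ?P"
  define G where "G = inv ?P \<circ> \<theta>"
  define S where "S = ?P -` (\<theta> ` W)"
  define T where "T = W \<inter> \<theta> -` range ?P"
  have W: "0 \<in> W" "\<theta> 0 = p" "inj_on \<theta> W" using fr by (auto simp: local_frame_def)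
  have "hol_compatible (cdom L i) ?P W \<theta>" using fr i(1) unfolding local_frame_def by blast
  then have S: "open S" "holo_map_on S F" and T: "open T" "holo_map_on T G"
    unfolding hol_compatible_def S_def T_def F_def G_def i(2) by (simp_all only: Int_UNIV_left)
  have GF: "G (F z) = z" "F z \<in> T" if "z \<in> S" for z
  proof -
    have "\<theta> (F z) = ?P z" "F z \<in> W" using that by (auto simp: F_def S_def f_inv_into_f inv_into_into)
    then show "G (F z) = z" "F z \<in> T" using inj by (auto simp: G_def T_def)
  qed
  have PG: "?P (G w) = \<theta> w" if "w \<in> T" for w
    using that by (auto simp: G_def T_def f_inv_into_f)
  have FG: "F (G w) = w" "G w \<in> S" if "w \<in> T" for w
    using PG[OF that] that W(3) by (auto simp: F_def S_def T_def)
  have "?P 0 \<in> \<theta> ` W" using W(1,2) p by (metis imageI)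
  moreover have "\<theta> 0 \<in> range ?P" using W(2) p by (metis rangeI)
  ultimately have 0: "0 \<in> S" "0 \<in> T" using W(1) unfolding S_def T_def by blast+
  have F0: "F 0 = 0" using W p by (auto simp: F_def)
  have G0: "G 0 = 0" using GF(1)[OF 0(1)] F0 by simp
  obtain DF where DF: "(F has_derivative DF) (at 0)" "\<And>c v. DF (c *s v) = c *s DF v"
    using holo_map_on_derivative[OF S(2) 0(1)] by auto
  obtain E where E: "(G has_derivative E) (at 0)" using holo_map_on_derivative[OF T(2) 0(2)] by auto
  have D: "D = DF" unfolding D_def F_def[symmetric] using frechet_derivative_at[OF DF(1)] ..
  have id: "B (A v) = v" if A: "(f has_derivative A) (at 0)" and B: "(g has_derivative B) (at 0)" and f0: "f 0 = 0"
    and gf: "\<And>z. z \<in> U \<Longrightarrow> g (f z) = z" and U: "open U" "0 \<in> U" for f g A B U and v :: "complex^'n"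
  proof -
    have "((\<lambda>z. g (f z)) has_derivative (\<lambda>v. B (A v))) (at 0)"
      by (rule has_derivative_compose[OF A]) (simp add: f0 B)
    moreover have "((\<lambda>z. g (f z)) has_derivative (\<lambda>v. v)) (at 0)"
      by (rule has_derivative_transform_within_open[OF has_derivative_ident U]) (simp add: gf)
    ultimately have "(\<lambda>v. B (A v)) = (\<lambda>v. v)" by (rule has_derivative_unique)
    then show ?thesis by (rule fun_cong)
  qed
  define \<tau>' where "\<tau>' z = \<tau> i (?P z)" for z
  have \<tau>'_holo: "holo_on S \<tau>'"
  proof -
    have "holo_on (cdom L i \<inter> ?P -` (\<theta> ` W)) (\<tau> i \<circ> ?P)"
      using fr i(1) unfolding local_frame_def by blast
    then show ?thesis by (simp add: i(2) S_def \<tau>'_def[abs_def] o_def)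
  qed
  have \<tau>'_nz: "\<tau>' z \<noteq> 0" if "z \<in> S" for z
  proof -
    have "?P z \<in> patch L i \<inter> \<theta> ` W" using that i(2) by (simp add: patch_def S_def)
    then show ?thesis using fr i(1) unfolding local_frame_def \<tau>'_def by blast
  qed
  have \<tau>'_cont: "isCont \<tau>' 0"
    using \<tau>'_holo 0(1) by (auto simp: holo_on_def dest: has_derivative_continuous)
  show thesis
  proof (rule that[of E "\<tau>' 0"])
    show "bounded_linear E" using E by (rule has_derivative_bounded_linear)
    show "E (D v) = v" for v unfolding D by (rule id[OF DF(1) E F0 GF(1) S(1) 0(1)])
    show "D (E v) = v" for v unfolding D by (rule id[OF E DF(1) G0 FG(1) T(1) 0(2)])
    show "\<tau>' 0 \<noteq> 0" using \<tau>'_nz 0 by blast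
    fix k s assume s: "s \<in> hol_sections L k"
    define f where "f z = s i (?P z)" for z
    let ?g = "local_expr L \<theta> \<tau> k s"
    have f: "holo_on UNIV f" using s i by (auto simp: hol_sections_def f_def[abs_def] o_def)
    have gG: "?g w = \<tau>' (G w) ^ k * f (G w)" if w: "w \<in> T" for w
    proof -
      have "w \<in> W" "\<theta> w \<in> patch L i" using w i(2) by (auto simp: T_def patch_def)
      from local_expr_eq[OF fr s i(1) this] show ?thesis by (simp add: \<tau>'_def f_def PG[OF w])
    qed
    have gF: "?g (F z) = \<tau>' z ^ k * f z" if "z \<in> S" for z
      using gG[OF GF(2)[OF that]] GF(1)[OF that] by simp
    have holo: "holo_on T (\<lambda>w. \<tau>' (G w) ^ k * f (G w))"
      using FG(2) by (intro holo_on_mult holo_on_power holo_on_compose[OF T(2) \<tau>'_holo]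
          holo_on_compose[OF T(2) f]) auto
    have gG': "\<forall>w\<in>T. ?g w = \<tau>' (G w) ^ k * f (G w)" using gG by blast
    have evS: "\<forall>\<^sub>F z in nhds 0. z \<in> S" using S(1) 0(1) by (rule eventually_nhds_in_open)
    show "((\<forall>w. hom_part ?g w = 0) \<and> (\<forall>\<^sub>F z in nhds 0. s i (?P z) = 0)) \<or>
       ((\<exists>w. hom_part ?g w \<noteq> 0) \<and>
        (\<exists>m. \<forall>\<xi>. ((\<lambda>c. s i (?P (c *s \<xi>)) / c ^ m) \<longlongrightarrow> hom_part ?g (D \<xi>) / \<tau>' 0 ^ k) (at 0)))"
    proof (cases rule: hom_part_dichotomy[OF holo T(1) 0(2) gG', case_names zero nonzero])
      case zero
      have "isCont F 0" using DF(1) by (rule has_derivative_continuous)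
      then have "filterlim F (nhds 0) (nhds 0)" using F0 tendsto_at_iff_tendsto_nhds[of F 0] by (simp add: isCont_def)
      with zero(2) have "\<forall>\<^sub>F z in nhds 0. ?g (F z) = 0" by (rule eventually_compose_filterlim)
      with evS have "\<forall>\<^sub>F z in nhds 0. s i (?P z) = 0"
        by eventually_elim (use gF \<tau>'_nz in \<open>auto simp: f_def\<close>)
      with zero(1) show ?thesis by blast
    next
      case nonzero
      let ?m = "vanishing_order ?g"
      have "((\<lambda>c. f (c *s \<xi>) / c ^ ?m) \<longlongrightarrow> hom_part ?g (D \<xi>) / \<tau>' 0 ^ k) (at 0)" for \<xi>
      proof -
        have l: "((\<lambda>c. c *s \<xi>) \<longlongrightarrow> 0) (at 0)"
          by (rule vec_tendstoI) (auto intro!: tendsto_eq_intros)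
        have "\<forall>\<^sub>F c in at 0. c *s \<xi> \<in> S"
          using eventually_compose_filterlim[OF evS l] .
        moreover have ne: "\<forall>\<^sub>F c in at (0::complex). c \<noteq> 0" by (rule eventually_neq_at_within)
        \<comment> \<open>\<open>F (c *s \<xi>)\<close> is written as \<open>c\<close> times a
          direction tending to \<open>D \<xi>\<close>, and the frame factor is divided out.\<close>
        ultimately have ev: "\<forall>\<^sub>F c in at 0. ?g (c *s (inverse c *s F (c *s \<xi>))) / c ^ ?m / \<tau>' (c *s \<xi>) ^ k
            = f (c *s \<xi>) / c ^ ?m"
        proof eventually_elim
          case (elim c)
          have "c *s (inverse c *s F (c *s \<xi>)) = F (c *s \<xi>)" using elim by (simp add: vec_eq_iff)
          then show ?case using gF[OF elim(1)] \<tau>'_nz[OF elim(1)] by simp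
        qed
        have "((\<lambda>c. \<tau>' (c *s \<xi>)) \<longlongrightarrow> \<tau>' 0) (at 0)"
          using isCont_tendsto_compose[OF \<tau>'_cont l] .
        then have "((\<lambda>c. ?g (c *s (inverse c *s F (c *s \<xi>))) / c ^ ?m / \<tau>' (c *s \<xi>) ^ k) \<longlongrightarrow>
            hom_part ?g (DF \<xi>) / \<tau>' 0 ^ k) (at 0)"
          by (intro tendsto_intros nonzero(2) derivative_quotient_tendsto[OF DF F0]) (use \<tau>'_nz 0 in auto)
        then show ?thesis unfolding D using ev by (rule Lim_transform_eventually)
      qed
      then show ?thesis using nonzero(1) unfolding f_def by blast
    qed
  qed
qed

section \<open>Comparison of the growth conditions\<close>

text \<open>The multiple by \<open>c\<close> of the character \<open>w\<close>, relative to the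
  generator of each chart; it is read off the point itself, without coordinates.\<close>

definition vertex_section :: "complex \<Rightarrow> int^'n \<Rightarrow> (int^'n) \<times> (int^'n^'n) \<Rightarrow> 'n toric_point \<Rightarrow> complex" where
  "vertex_section c w = (\<lambda>(u, B) x. c * the (x (w - u)))"

lemma vertex_section_chart:
  assumes "delzant \<Delta>" and "w \<in> lattice_vertices \<Delta>" and "(u, B) \<in> vertex_frames \<Delta>"
  shows "vertex_section c w (u, B) (toric_param B z) = c * lmonomial (B *v (w - u)) z"
  using frame_vertex_nonneg[OF assms(1,3,2)]
  by (simp add: vertex_section_def toric_param_Some)

lemma vertex_section_hol:
  fixes \<Delta> :: "(real^'n::finite) set"
  assumes \<Delta>: "delzant \<Delta>" and w: "w \<in> lattice_vertices \<Delta>"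
  shows "vertex_section c w \<in> hol_sections (toric_bundle \<Delta>) 1"
  unfolding hol_sections_def mem_Collect_eq
proof (intro conjI ballI)
  fix i assume i: "i \<in> idx (toric_bundle \<Delta>)"
  obtain u B where uB: "i = (u, B)" by (cases i)
  then have f: "(u, B) \<in> vertex_frames \<Delta>" using i by simp
  have "vertex_section c w (u, B) \<circ> toric_param B = (\<lambda>z. c * lmonomial (B *v (w - u)) z)"
    using vertex_section_chart[OF \<Delta> w f] by (simp add: fun_eq_iff)
  moreover have "holo_on UNIV (\<lambda>z. c * lmonomial (B *v (w - u)) z)"
    unfolding lmonomial_nonneg[OF frame_vertex_nonneg[OF \<Delta> f w]]
    by (intro holo_on_mult holo_on_const holo_on_monomial)
  ultimately show "holo_on (cdom (toric_bundle \<Delta>) i) (vertex_section c w i \<circ> par (toric_bundle \<Delta>) i)"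
    by (simp add: uB)
  fix j x assume j: "j \<in> idx (toric_bundle \<Delta>)" and x: "x \<in> patch (toric_bundle \<Delta>) i \<inter> patch (toric_bundle \<Delta>) j"
  obtain u' B' where uB': "j = (u', B')" by (cases j)
  then have f': "(u', B') \<in> vertex_frames \<Delta>" using j by simp
  obtain z where z: "x = toric_param B z" using x by (auto simp: uB)
  obtain y where y: "x = toric_param B' y" using x by (auto simp: uB')
  let ?a = "B *v (u' - u)" and ?b = "B *v (w - u')"
  \<comment> \<open>In its own chart this exponent is nonnegative, so the character is regular at
    \<open>x\<close>. Seen from the chart of \<open>B\<close>, regularity means nonnegative
    exponents wherever \<open>z\<close> vanishes, which is what additivity needs.\<close>
  have "x (w - u') = Some (lmonomial (B' *v (w - u')) y)"
    unfolding y by (intro toric_param_Some frame_vertex_nonneg[OF \<Delta> f' w])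
  then have nb: "0 \<le> ?b $ l" if "z $ l = 0" for l
    using that unfolding z toric_param_def by (auto split: if_splits)
  have na: "0 \<le> ?a $ l" for l
    by (rule frame_vertex_nonneg[OF \<Delta> f vertex_frames_vertex[OF f']])
  have "B *v (w - u) = ?a + ?b" by (simp add: matrix_vector_right_distrib[symmetric])
  then have "lmonomial (B *v (w - u)) z = lmonomial ?a z * lmonomial ?b z"
    using na nb by (simp add: lmonomial_add)
  moreover have "x (w - u') = Some (lmonomial ?b z)" "x (u' - u) = Some (lmonomial ?a z)"
    unfolding z using na nb by (simp_all add: toric_param_Some)
  moreover have "vertex_section c w i x = c * lmonomial (B *v (w - u)) z"
    unfolding uB z by (rule vertex_section_chart[OF \<Delta> w f])
  ultimately show "vertex_section c w i x = trf (toric_bundle \<Delta>) i j x ^ 1 * vertex_section c w j x"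
    by (simp add: uB uB' vertex_section_def)
qed

lemma le_usc_reg: "u z \<le> usc_reg u z"
  unfolding usc_reg_def Limsup_def
  by (intro INF_greatest SUP_upper) (auto dest: eventually_nhds_x_imp_x)

lemma usc_reg_le_continuous:
  assumes "\<And>y. u y \<le> ereal (h y)" and "isCont h z"
  shows "usc_reg u z \<le> ereal (h z)"
proof -
  have "(h \<longlongrightarrow> h z) (nhds z)" using assms(2) by (simp add: isCont_def tendsto_at_iff_tendsto_nhds)
  then have "((\<lambda>y. ereal (h y)) \<longlongrightarrow> ereal (h z)) (nhds z)" by (rule tendsto_ereal)
  then have "Limsup (nhds z) (\<lambda>y. ereal (h y)) = ereal (h z)" by (intro lim_imp_Limsup) auto
  then show ?thesis unfolding usc_reg_def
    using Limsup_mono[of u "\<lambda>y. ereal (h y)" "nhds z"] assms(1) by auto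
qed

text \<open>If \<open>m < d\<close> all limits would be 0, and if \<open>d < m\<close> the function
  \<open>f\<close> would vanish; so \<open>m = d\<close>. This identifies the leading part of a
  vertex section with its monomial.\<close>

lemma power_ratio_limit:
  fixes H :: "'a \<Rightarrow> complex"
  assumes lim: "\<And>\<xi>. ((\<lambda>c. c ^ d * f \<xi> / c ^ m) \<longlongrightarrow> H \<xi>) (at 0)"
    and "f \<xi>1 \<noteq> 0" and "H \<xi>2 \<noteq> 0"
  shows "H \<xi> = f \<xi>"
proof -
  have nz: "\<forall>\<^sub>F c in at (0::complex). c \<noteq> 0" by (rule eventually_neq_at_within)
  have pow: "((\<lambda>c::complex. c ^ Suc j) \<longlongrightarrow> 0) (at 0)" for j by (auto intro!: tendsto_eq_intros)
  have "\<not> m < d"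
  proof
    assume "m < d"
    then obtain j where j: "d = m + Suc j" using less_iff_Suc_add by auto
    have "((\<lambda>c. c ^ Suc j * f \<xi>2) \<longlongrightarrow> 0) (at 0)" using tendsto_mult_left_zero[OF pow] .
    then have "((\<lambda>c. c ^ d * f \<xi>2 / c ^ m) \<longlongrightarrow> 0) (at 0)"
      by (rule Lim_transform_eventually) (use nz in \<open>eventually_elim, simp add: j power_add\<close>)
    then show False using LIM_unique[OF lim] assms(3) by blast
  qed
  moreover have "\<not> d < m"
  proof
    assume "d < m"
    then obtain j where j: "m = d + Suc j" using less_iff_Suc_add by auto
    have "((\<lambda>c. c ^ d * f \<xi>1 / c ^ m * c ^ Suc j) \<longlongrightarrow> H \<xi>1 * 0) (at 0)"
      by (rule tendsto_mult[OF lim pow])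
    then have "((\<lambda>c::complex. f \<xi>1) \<longlongrightarrow> H \<xi>1 * 0) (at 0)"
      by (rule Lim_transform_eventually) (use nz in \<open>eventually_elim, simp add: j power_add\<close>)
    then show False using assms(2) by (simp add: tendsto_const_iff)
  qed
  ultimately have "m = d" by simp
  have "((\<lambda>c::complex. f \<xi>) \<longlongrightarrow> H \<xi>) (at 0)"
    by (rule Lim_transform_eventually[OF lim]) (use nz in \<open>eventually_elim, simp add: \<open>m = d\<close>\<close>)
  then show ?thesis by (simp add: tendsto_const_iff)
qed

text \<open>The toric growth is written in chart coordinates and the canonical growth in those of
  the frame; the derivative is the resulting identification of tangent spaces. A finite bound in
  \<open>ereal\<close> also says that the canonical growth is finite everywhere.\<close>

theorem theorem1p3:
  fixes \<Delta> :: "(real^'n) set"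
    and p :: "'n toric_point"
    and v :: "int^'n" and A :: "int^'n^'n" and k :: nat
    and \<phi> :: "(int^'n) \<times> (int^'n^'n) \<Rightarrow> 'n toric_point \<Rightarrow> real"
    and W :: "(complex^'n) set" and \<theta> :: "complex^'n \<Rightarrow> 'n toric_point"
    and \<tau> :: "(int^'n) \<times> (int^'n^'n) \<Rightarrow> 'n toric_point \<Rightarrow> complex"
  assumes "delzant \<Delta>"
    and "p \<in> toric_manifold \<Delta>" and "torus_fixed p"
    and "(v, A) \<in> vertex_frames \<Delta>" and "toric_param A 0 = p"
    and "k \<ge> 1"
    and "smooth_metric (toric_bundle \<Delta>) \<phi>"
    and "local_frame (toric_bundle \<Delta>) p W \<theta> \<tau>"
  shows "\<exists>C::real. \<forall>\<xi>.
    \<bar>canonical_growth (toric_bundle \<Delta>) \<phi> \<theta> \<tau>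
        (frechet_derivative (inv_into W \<theta> \<circ> toric_param A) (at 0) \<xi>)
      - ereal (toric_growth \<Delta> v A k \<xi>)\<bar> \<le> ereal C"
proof -
  note \<Delta> = assms(1) and vA = assms(4) and k = assms(6) and \<phi> = assms(7) and fr = assms(8)
  let ?L = "toric_bundle \<Delta>" and ?T = "toric_growth \<Delta> v A k" and ?P = "toric_param A"
  define D where "D = frechet_derivative (inv_into W \<theta> \<circ> ?P) (at 0)"
  have "invertible A" using vA by (simp add: vertex_frames_def straightens_def)
  then have inj: "inj (par ?L (v, A))" by (simp add: inj_toric_param)
  let ?H = "\<lambda>k s. hom_part (local_expr ?L \<theta> \<tau> k s)"
  obtain E t where E: "bounded_linear E" and ED: "\<And>v. E (D v) = v" and DE: "\<And>v. D (E v) = v"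
    and t: "t \<noteq> 0"
    and H: "\<And>k s. s \<in> hol_sections ?L k \<Longrightarrow>
       ((\<forall>w. ?H k s w = 0) \<and> (\<forall>\<^sub>F z in nhds 0. s (v, A) (?P z) = 0)) \<or>
       ((\<exists>w. ?H k s w \<noteq> 0) \<and>
        (\<exists>m. \<forall>\<xi>. ((\<lambda>c. s (v, A) (?P (c *s \<xi>)) / c ^ m) \<longlongrightarrow> ?H k s (D \<xi>) / t ^ k) (at 0)))"
    using hom_part_local_expr[OF fr, of "(v, A)"] vA inj assms(5)
    unfolding toric_bundle_sel D_def by blast
  let ?S = "{(k, s). 1 \<le> k \<and> s \<in> unit_ball_sections ?L \<phi> k \<and> nonzero_section ?L s}"
  define u where "u z = (SUP (k, s) \<in> ?S. ereal (1 / real k) * ln_abs_sq (?H k s z))" for z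
  have cg: "canonical_growth ?L \<phi> \<theta> \<tau> = usc_reg u" by (simp add: canonical_growth_def u_def[abs_def])
  obtain C1 where C1: "\<And>z. \<phi> (v, A) (?P z) \<le> C1 + ?T z"
    using metric_le_toric_growth[OF \<Delta> vA k \<phi>] by blast
  \<comment> \<open>The frame multiplies leading parts of sections of the \<open>j\<close>-th power
    by \<open>t ^ j\<close>, which normalizes to \<open>ln ((cmod t)\<^sup>2)\<close> for every
    \<open>j\<close>.\<close>
  define Cu where "Cu = ln ((cmod t)\<^sup>2) + C1"
  have term_le: "ereal (1 / real j) * ln_abs_sq (?H j s y) \<le> ereal (Cu + ?T (E y))"
    if j: "1 \<le> j" and s: "s \<in> unit_ball_sections ?L \<phi> j" for j s y
  proof (cases "?H j s y = 0")
    case True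
    then show ?thesis using j by (simp add: ln_abs_sq_def)
  next
    case False
    have sh: "s \<in> hol_sections ?L j" using s by (simp add: unit_ball_sections_def)
    then obtain m where "((\<lambda>c. s (v, A) (?P (c *s E y)) / c ^ m) \<longlongrightarrow> ?H j s (D (E y)) / t ^ j) (at 0)"
      using H[OF sh] False by blast
    then have lim: "((\<lambda>c. s (v, A) (?P (c *s E y)) / c ^ m) \<longlongrightarrow> ?H j s y / t ^ j) (at 0)" by (simp add: DE)
    have "holo_on UNIV (s (v, A) \<circ> ?P)"
      using sh vA unfolding hol_sections_def by (metis (no_types, lifting) mem_Collect_eq toric_bundle_sel(1,2,3))
    then have hol: "(\<lambda>c. s (v, A) (?P (c *s E y))) holomorphic_on UNIV"
      using holo_on_line[of "s (v, A) \<circ> ?P"] by (simp add: o_def)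
    have "cmod (s (v, A) (?P (c *s E y))) \<le> exp (real j * (C1 + ?T (E y)) / 2)" if c: "cmod c = 1" for c
    proof -
      have "(cmod (s (v, A) (?P z)))\<^sup>2 * exp (- real j * \<phi> (v, A) (?P z)) \<le> 1" for z
        using s vA unfolding unit_ball_sections_def by (auto dest!: bspec[of _ _ "(v, A)"])
      then have "(cmod (s (v, A) (?P (c *s E y))))\<^sup>2 \<le> exp (real j * \<phi> (v, A) (?P (c *s E y)))"
        by (simp add: exp_minus field_simps)
      also have "\<dots> \<le> exp (real j * (C1 + ?T (E y)))"
        using C1[of "c *s E y"] by (simp add: toric_growth_rotate[OF \<Delta> vA k c] mult_left_mono)
      also have "\<dots> = (exp (real j * (C1 + ?T (E y)) / 2))\<^sup>2"
        by (simp add: power2_eq_square mult_exp_exp)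
      finally show ?thesis by (rule power2_le_imp_le) simp
    qed
    from leading_coeff_bound[OF hol lim this]
    have "(cmod (?H j s y / t ^ j))\<^sup>2 \<le> (exp (real j * (C1 + ?T (E y)) / 2))\<^sup>2" by (intro power_mono) auto
    also have "\<dots> = exp (real j * (C1 + ?T (E y)))" by (simp add: power2_eq_square mult_exp_exp)
    finally have "(cmod (?H j s y))\<^sup>2 \<le> ((cmod t)\<^sup>2) ^ j * exp (real j * (C1 + ?T (E y)))"
      using t by (simp add: norm_divide norm_power power_divide field_simps flip: power_mult)
    also have "\<dots> = exp (real j * (Cu + ?T (E y)))"
      using t by (simp add: Cu_def exp_add exp_of_nat_mult distrib_left power_mult_distrib)
    finally have "ln ((cmod (?H j s y))\<^sup>2) \<le> real j * (Cu + ?T (E y))"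
      using False ln_le_cancel_iff[of "(cmod (?H j s y))\<^sup>2" "exp (real j * (Cu + ?T (E y)))"] by simp
    then have "1 / real j * ln ((cmod (?H j s y))\<^sup>2) \<le> Cu + ?T (E y)"
      using j by (simp add: field_simps)
    then show ?thesis using False by (simp add: ln_abs_sq_def)
  qed
  then have u_le: "u y \<le> ereal (Cu + ?T (E y))" for y
    unfolding u_def by (intro SUP_least) auto
  have upper: "usc_reg u (D \<xi>) \<le> ereal (Cu + ?T \<xi>)" for \<xi>
  proof -
    have "continuous_on UNIV (\<lambda>y. Cu + ?T (E y))"
      by (intro continuous_intros continuous_on_compose2[OF continuous_on_toric_growth[OF \<Delta> vA k, of UNIV]]
          linear_continuous_on E) auto
    then have "isCont (\<lambda>y. Cu + ?T (E y)) (D \<xi>)" by (simp add: continuous_on_eq_continuous_at)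
    from usc_reg_le_continuous[OF u_le this] show ?thesis by (simp add: ED)
  qed
  obtain C2 where C2: "\<And>u B w z. (u, B) \<in> vertex_frames \<Delta> \<Longrightarrow> w \<in> lattice_vertices \<Delta> \<Longrightarrow>
    (cmod (lmonomial (B *v (w - u)) z))\<^sup>2 \<le> exp (C2 + \<phi> (u, B) (toric_param B z))"
    using vertex_section_bound[OF \<Delta> \<phi>] by blast
  \<comment> \<open>Halved because \<open>C2\<close> bounds squared moduli.\<close>
  define a where "a = complex_of_real (exp (- C2 / 2))"
  have a: "(cmod a)\<^sup>2 = exp (- C2)" "a \<noteq> 0" by (simp_all add: a_def power2_eq_square mult_exp_exp)
  define N where "N = real (card (growth_exponents \<Delta> v A k))"
  have lower: "ereal (?T \<xi> - (ln N - ln ((cmod t)\<^sup>2) + C2)) \<le> usc_reg u (D \<xi>)" for \<xi>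
  proof -
    \<comment> \<open>The vertex varies with \<xi>, but the constants \<open>N\<close>,
      \<open>t\<close> and \<open>C2\<close> do not.\<close>
    obtain w where w: "w \<in> lattice_vertices \<Delta>" "lmonomial (A *v (w - v)) \<xi> \<noteq> 0"
      "?T \<xi> \<le> ln N + ln ((cmod (lmonomial (A *v (w - v)) \<xi>))\<^sup>2)"
      using toric_growth_le_vertex[OF \<Delta> vA k, of \<xi>] unfolding N_def by blast
    define s where "s = vertex_section a w"
    define f where "f z = a * lmonomial (A *v (w - v)) z" for z
    have sP: "s (v, A) (?P z) = f z" for z
      unfolding s_def f_def by (rule vertex_section_chart[OF \<Delta> w(1) vA])
    have sh: "s \<in> hol_sections ?L 1" unfolding s_def by (rule vertex_section_hol[OF \<Delta> w(1)])
    have "(cmod (s i x))\<^sup>2 * exp (- real 1 * \<phi> i x) \<le> 1" if i: "i \<in> idx ?L" "x \<in> patch ?L i" for i x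
    proof -
      obtain u' B where uB: "i = (u', B)" by (cases i)
      then obtain z where z: "x = toric_param B z" using i by auto
      have f': "(u', B) \<in> vertex_frames \<Delta>" using i uB by simp
      have "(cmod (s i x))\<^sup>2 = exp (- C2) * (cmod (lmonomial (B *v (w - u')) z))\<^sup>2"
        unfolding s_def uB z vertex_section_chart[OF \<Delta> w(1) f'] by (simp add: norm_mult power_mult_distrib a)
      also have "\<dots> \<le> exp (- C2) * exp (C2 + \<phi> i x)"
        unfolding uB z by (intro mult_left_mono C2[OF f' w(1)]) auto
      also have "\<dots> = exp (\<phi> i x)" by (simp add: mult_exp_exp)
      finally show ?thesis by (simp add: exp_minus field_simps)
    qed
    then have sb: "s \<in> unit_ball_sections ?L \<phi> 1" using sh by (simp add: unit_ball_sections_def)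
    have "f \<xi> \<noteq> 0" using w(2) a by (simp add: f_def)
    then have "nonzero_section ?L s"
      unfolding nonzero_section_def using vA sP by (intro bexI[of _ "(v, A)"] bexI[of _ "?P \<xi>"]) auto
    then have "ereal (1 / real 1) * ln_abs_sq (?H 1 s (D \<xi>)) \<le> u (D \<xi>)"
      unfolding u_def using sb by (intro SUP_upper2[of "(1, s)"]) auto
    then have u_ge: "ln_abs_sq (?H 1 s (D \<xi>)) \<le> u (D \<xi>)" by simp
    \<comment> \<open>Excludes the first alternative in \<open>H\<close>: the monomial has no zeros
      on the torus, which meets every neighbourhood of 0.\<close>
    have not_zero: "\<not> (\<forall>\<^sub>F z in nhds 0. s (v, A) (?P z) = 0)"
    proof
      assume "\<forall>\<^sub>F z in nhds 0. s (v, A) (?P z) = 0"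
      then obtain U where U: "open U" "0 \<in> U" "\<And>z. z \<in> U \<Longrightarrow> f z = 0"
        by (auto simp: eventually_nhds sP)
      then have "U \<inter> torus \<noteq> {}" using open_Int_closure_eq_empty[OF U(1), of torus] closure_torus by auto
      then obtain z where "z \<in> torus" "f z = 0" using U(3) by blast
      then show False using lmonomial_nonzero a by (auto simp: f_def)
    qed
    obtain m y where m: "\<And>\<xi>. ((\<lambda>c. s (v, A) (?P (c *s \<xi>)) / c ^ m) \<longlongrightarrow> ?H 1 s (D \<xi>) / t ^ 1) (at 0)"
      and y: "?H 1 s y \<noteq> 0"
      using H[OF sh] not_zero by blast
    define d where "d = total_deg (\<chi> l. nat ((A *v (w - v)) $ l))"
    have fs: "f (c *s z) = c ^ d * f z" for c z
      unfolding f_def lmonomial_nonneg[OF frame_vertex_nonneg[OF \<Delta> vA w(1)]] d_def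
      by (simp add: monomial_scale)
    have "?H 1 s (D \<xi>) / t ^ 1 = f \<xi>"
    proof (rule power_ratio_limit[where f = f and H = "\<lambda>\<xi>. ?H 1 s (D \<xi>) / t ^ 1"])
      show "((\<lambda>c. c ^ d * f \<xi> / c ^ m) \<longlongrightarrow> ?H 1 s (D \<xi>) / t ^ 1) (at 0)" for \<xi>
        using m[of \<xi>] by (simp only: sP fs)
      show "f \<xi> \<noteq> 0" by fact
      show "?H 1 s (D (E y)) / t ^ 1 \<noteq> 0" using y t by (simp add: DE)
    qed
    then have Heq: "?H 1 s (D \<xi>) = t * f \<xi>" using t by (simp add: field_simps)
    have "ln ((cmod (t * f \<xi>))\<^sup>2) = ln ((cmod t)\<^sup>2 * exp (- C2) * (cmod (lmonomial (A *v (w - v)) \<xi>))\<^sup>2)"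
      by (simp add: f_def norm_mult power_mult_distrib a mult_ac)
    also have "\<dots> = ln ((cmod t)\<^sup>2) - C2 + ln ((cmod (lmonomial (A *v (w - v)) \<xi>))\<^sup>2)"
      using t w(2) by (simp add: ln_mult_pos)
    finally have "?T \<xi> - (ln N - ln ((cmod t)\<^sup>2) + C2) \<le> ln ((cmod (t * f \<xi>))\<^sup>2)"
      using w(3) by linarith
    moreover have "ln_abs_sq (?H 1 s (D \<xi>)) = ereal (ln ((cmod (t * f \<xi>))\<^sup>2))"
      using t \<open>f \<xi> \<noteq> 0\<close> unfolding ln_abs_sq_def Heq by simp
    ultimately have "ereal (?T \<xi> - (ln N - ln ((cmod t)\<^sup>2) + C2)) \<le> ln_abs_sq (?H 1 s (D \<xi>))" by simp
    also note u_ge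
    also have "u (D \<xi>) \<le> usc_reg u (D \<xi>)" by (rule le_usc_reg)
    finally show ?thesis .
  qed
  define C where "C = max Cu (ln N - ln ((cmod t)\<^sup>2) + C2)"
  have "\<bar>usc_reg u (D \<xi>) - ereal (?T \<xi>)\<bar> \<le> ereal C" for \<xi>
  proof -
    \<comment> \<open>The two bounds force the value to be finite, so the rest is real
      arithmetic.\<close>
    obtain r where r: "usc_reg u (D \<xi>) = ereal r"
      using upper[of \<xi>] lower[of \<xi>] by (cases "usc_reg u (D \<xi>)") auto
    have "Cu \<le> C" "ln N - ln ((cmod t)\<^sup>2) + C2 \<le> C" by (simp_all add: C_def)
    moreover have "r \<le> Cu + ?T \<xi>" "?T \<xi> - (ln N - ln ((cmod t)\<^sup>2) + C2) \<le> r"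
      using upper[of \<xi>] lower[of \<xi>] by (simp_all add: r)
    ultimately have "\<bar>r - ?T \<xi>\<bar> \<le> C" by linarith
    then show ?thesis by (simp add: r)
  qed
  then show ?thesis unfolding cg D_def[symmetric] by blast
qed

end
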